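(* Let $P$ be a special ample polytope. The semigroup $S_P = \overline{S_P}$ (the two semigroups are equal) is presented by quadratic relations. In other words, $S_P = \langle \Lambda(P)\times\{1\}\rangle/(R)$ (the free commutative semigroup on the set $\Lambda(P)\times\{1\}$ modulo the relations $R$), where $R$ is spanned by the elements $$(x,1)(y,1) - (x',1)(y',1)$$ for $x,y,x',y' \in \Lambda(P)$ such that $x+y = x'+y'$.
   Context: Let $\Phi$ be an irreducible, reduced (finite, crystallographic) root system of rank $n$, with set of roots $\Delta$, root lattice $Y$, weight lattice $X \supseteq Y$, coroot lattice $X^\vee$, coweight lattice $Y^\vee$, and pairing $\langle\,,\rangle : X \times X^\vee \to \mathbb{Z}$ extended to $(X\otimes_{\mathbb Z}\mathbb{R})\times X^\vee$. Let $F_n$ be the set of Weyl chambers in $Y^\vee \otimes_{\mathbb Z} \mathbb{R}$. For $\sigma\in F_n$ let $\{\alpha_{i,\sigma} : 1\le i\le n\}$ be the corresponding simple roots; $x \in X\otimes_{\mathbb Z}\mathbb{R}$ is $\sigma$-dominant if $\langle x, \alpha_{i,\sigma}^\vee\rangle \ge 0$ for all $i$. For adjacent chambers $\sigma,\sigma'$, $\alpha_{\sigma,\sigma'}\in\Delta$ is the unique root positive on $\sigma$ and negative on $\sigma'$. An ample polytope is a convex polytope $P \subset X\otimes_{\mathbb Z}\mathbb{R}$ whose vertices are given by a set $\{\mu_\sigma : \sigma\in F_n\} \subset X$ such that for adjacent $\sigma,\sigma'$, $\mu_\sigma - \mu_{\sigma'} = r_{\sigma,\sigma'}\alpha_{\sigma,\sigma'}$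 with $r_{\sigma,\sigma'} \in \mathbb{Z}_{>0}$. It is special if $\mu_\sigma$ is $\sigma$-dominant for every $\sigma$. Put $\Lambda(P) := P \cap (\mu_\sigma + Y)$ (independent of $\sigma$); $mP=\{mx: x\in P\}$ is again a special ample polytope, with vertices $m\mu_\sigma$. $S_P \subset X\times\mathbb{Z}$ is the semigroup generated by the elements $(x,1)$, $x\in\Lambda(P)$. Its saturation is $\overline{S_P} := \bigcup_{m\ge 1} \Lambda(mP)\times\{m\}$, i.e. the intersection of the cone $\mathbb{R}_{>0}\cdot(P\times\{1\})$ with the lattice $\{(y+t\mu_\sigma,t) : y\in Y, t\in\mathbb{Z}\}$, for any fixed $\sigma\in F_n$. Being presented modulo $(R)$ means: quotient by the smallest congruence identifying $(x,1)(y,1)$ with $(x',1)(y',1)$ for each listed relation, the identification with $S_P$ being induced by sending each generator $(x,1)$ to itself. *)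

theory Defs
  imports "HOL-Analysis.Analysis" "HOL-Library.Multiset"
begin

text \<open>
  A root system of rank $n$ lives in a Euclidean space of dimension $n$, which plays the role of
  $X \otimes \mathbb{R}$. The dual space $Y^\vee \otimes \mathbb{R} = X^\vee \otimes \mathbb{R}$
  is identified with the same space through the inner product, so that the pairing is the inner
  product and $\alpha^\vee = 2\alpha/(\alpha,\alpha)$.
\<close>

definition coroot :: "'a::euclidean_space \<Rightarrow> 'a" where
  "coroot \<alpha> = (2 / (\<alpha> \<bullet> \<alpha>)) *\<^sub>R \<alpha>"

definition root_reflection :: "'a::euclidean_space \<Rightarrow> 'a \<Rightarrow> 'a" where
  "root_reflection \<alpha> x = x - (x \<bullet> coroot \<alpha>) *\<^sub>R \<alpha>"

definition root_system :: "'a::euclidean_space set \<Rightarrow> bool" where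
  "root_system \<Delta> \<longleftrightarrow> finite \<Delta> \<and> 0 \<notin> \<Delta> \<and> span \<Delta> = UNIV
     \<and> (\<forall>\<alpha>\<in>\<Delta>. root_reflection \<alpha> ` \<Delta> \<subseteq> \<Delta>)
     \<and> (\<forall>\<alpha>\<in>\<Delta>. \<forall>\<beta>\<in>\<Delta>. \<beta> \<bullet> coroot \<alpha> \<in> \<int>)"

definition reduced :: "'a::euclidean_space set \<Rightarrow> bool" where
  "reduced \<Delta> \<longleftrightarrow> (\<forall>\<alpha>\<in>\<Delta>. \<forall>c. c *\<^sub>R \<alpha> \<in> \<Delta> \<longrightarrow> c = 1 \<or> c = -1)"

definition irreducible_roots :: "'a::euclidean_space set \<Rightarrow> bool" where
  "irreducible_roots \<Delta> \<longleftrightarrow> \<Delta> \<noteq> {} \<and>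
     \<not> (\<exists>A B. A \<noteq> {} \<and> B \<noteq> {} \<and> A \<inter> B = {} \<and> A \<union> B = \<Delta> \<and> (\<forall>\<alpha>\<in>A. \<forall>\<beta>\<in>B. \<alpha> \<bullet> \<beta> = 0))"

definition integer_span :: "'a::euclidean_space set \<Rightarrow> 'a set" where
  "integer_span B = {(\<Sum>b\<in>B. of_int (c b) *\<^sub>R b) | c :: 'a \<Rightarrow> int. True}"

definition root_lattice :: "'a::euclidean_space set \<Rightarrow> 'a set" where
  "root_lattice \<Delta> = integer_span \<Delta>"

definition coroot_lattice :: "'a::euclidean_space set \<Rightarrow> 'a set" where
  "coroot_lattice \<Delta> = integer_span (coroot ` \<Delta>)"

definition weight_lattice :: "'a::euclidean_space set \<Rightarrow> 'a set" where
  "weight_lattice \<Delta> = {x. \<forall>v\<in>coroot_lattice \<Delta>. x \<bullet> v \<in> \<int>}"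

text \<open>
  Weyl chambers are taken to be open, hence the closures in the notion of adjacency. The simple roots
  of a chamber are the positive roots that are not sums of two positive roots.
\<close>

definition weyl_chambers :: "'a::euclidean_space set \<Rightarrow> 'a set set" where
  "weyl_chambers \<Delta> = components (- (\<Union>\<alpha>\<in>\<Delta>. {v. \<alpha> \<bullet> v = 0}))"

definition positive_roots :: "'a::euclidean_space set \<Rightarrow> 'a set \<Rightarrow> 'a set" where
  "positive_roots \<Delta> \<sigma> = {\<alpha>\<in>\<Delta>. \<forall>v\<in>\<sigma>. \<alpha> \<bullet> v > 0}"

definition simple_roots :: "'a::euclidean_space set \<Rightarrow> 'a set \<Rightarrow> 'a set" where
  "simple_roots \<Delta> \<sigma> = {\<alpha>\<in>positive_roots \<Delta> \<sigma>.
     \<not> (\<exists>\<beta>\<in>positive_roots \<Delta> \<sigma>. \<exists>\<gamma>\<in>positive_roots \<Delta> \<sigma>. \<alpha> = \<beta> + \<gamma>)}"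

definition dominant :: "'a::euclidean_space set \<Rightarrow> 'a set \<Rightarrow> 'a \<Rightarrow> bool" where
  "dominant \<Delta> \<sigma> x \<longleftrightarrow> (\<forall>\<alpha>\<in>simple_roots \<Delta> \<sigma>. x \<bullet> coroot \<alpha> \<ge> 0)"

definition adjacent :: "'a::euclidean_space set \<Rightarrow> 'a set \<Rightarrow> bool" where
  "adjacent \<sigma> \<sigma>' \<longleftrightarrow> (closure \<sigma> \<inter> closure \<sigma>') facet_of closure \<sigma>
     \<and> (closure \<sigma> \<inter> closure \<sigma>') facet_of closure \<sigma>'"

definition separating_root :: "'a::euclidean_space set \<Rightarrow> 'a set \<Rightarrow> 'a set \<Rightarrow> 'a" where
  "separating_root \<Delta> \<sigma> \<sigma>' =
     (THE \<alpha>. \<alpha> \<in> \<Delta> \<and> (\<forall>v\<in>\<sigma>. \<alpha> \<bullet> v > 0) \<and> (\<forall>v\<in>\<sigma>'. \<alpha> \<bullet> v < 0))"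

text \<open>
  The labelling \<open>\<mu>\<close> of the vertices by chambers is carried along explicitly; its values outside
  \<open>weyl_chambers \<Delta>\<close> are irrelevant.
\<close>

definition ample_polytope ::
    "'a::euclidean_space set \<Rightarrow> 'a set \<Rightarrow> ('a set \<Rightarrow> 'a) \<Rightarrow> bool" where
  "ample_polytope \<Delta> P \<mu> \<longleftrightarrow> polytope P
     \<and> {x. x extreme_point_of P} = \<mu> ` weyl_chambers \<Delta>
     \<and> (\<forall>\<sigma>\<in>weyl_chambers \<Delta>. \<mu> \<sigma> \<in> weight_lattice \<Delta>)
     \<and> (\<forall>\<sigma>\<in>weyl_chambers \<Delta>. \<forall>\<sigma>'\<in>weyl_chambers \<Delta>. adjacent \<sigma> \<sigma>' \<longrightarrow>
          (\<exists>r::int. r > 0 \<and> \<mu> \<sigma> - \<mu> \<sigma>' = of_int r *\<^sub>R separating_root \<Delta> \<sigma> \<sigma>'))"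

definition special_ample_polytope ::
    "'a::euclidean_space set \<Rightarrow> 'a set \<Rightarrow> ('a set \<Rightarrow> 'a) \<Rightarrow> bool" where
  "special_ample_polytope \<Delta> P \<mu> \<longleftrightarrow> ample_polytope \<Delta> P \<mu>
     \<and> (\<forall>\<sigma>\<in>weyl_chambers \<Delta>. dominant \<Delta> \<sigma> (\<mu> \<sigma>))"

text \<open>
  \<open>lattice_points \<Delta> P \<mu> \<sigma>\<close> is $\Lambda(P) = P \cap (\mu_\sigma + Y)$, which for ample $P$ does not
  depend on the chamber \<open>\<sigma>\<close>.
\<close>

definition lattice_points ::
    "'a::euclidean_space set \<Rightarrow> 'a set \<Rightarrow> ('a set \<Rightarrow> 'a) \<Rightarrow> 'a set \<Rightarrow> 'a set" where
  "lattice_points \<Delta> P \<mu> \<sigma> = P \<inter> (+) (\<mu> \<sigma>) ` root_lattice \<Delta>"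

inductive_set generated_semigroup :: "'b::ab_semigroup_add set \<Rightarrow> 'b set" for G where
  gen: "g \<in> G \<Longrightarrow> g \<in> generated_semigroup G"
| add: "s \<in> generated_semigroup G \<Longrightarrow> t \<in> generated_semigroup G \<Longrightarrow> s + t \<in> generated_semigroup G"

text \<open>
  Semigroups need not have a neutral element; accordingly the free commutative semigroup on \<open>G\<close>
  consists of the nonempty finite multisets of elements of \<open>G\<close>.
\<close>

definition free_comm_semigroup :: "'b set \<Rightarrow> 'b multiset set" where
  "free_comm_semigroup G = {M. M \<noteq> {#} \<and> set_mset M \<subseteq> G}"

inductive_set generated_congruence ::
    "'b set \<Rightarrow> ('b multiset \<times> 'b multiset) set \<Rightarrow> ('b multiset \<times> 'b multiset) set"
  for G R where
  rel: "(M, N) \<in> R \<Longrightarrow> M \<in> free_comm_semigroup G \<Longrightarrow> N \<in> free_comm_semigroup G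
          \<Longrightarrow> (M, N) \<in> generated_congruence G R"
| refl: "M \<in> free_comm_semigroup G \<Longrightarrow> (M, M) \<in> generated_congruence G R"
| sym: "(M, N) \<in> generated_congruence G R \<Longrightarrow> (N, M) \<in> generated_congruence G R"
| trans: "(M, N) \<in> generated_congruence G R \<Longrightarrow> (N, K) \<in> generated_congruence G R
          \<Longrightarrow> (M, K) \<in> generated_congruence G R"
| add: "(M, N) \<in> generated_congruence G R \<Longrightarrow> K \<in> free_comm_semigroup G
          \<Longrightarrow> (M + K, N + K) \<in> generated_congruence G R"

definition class_add ::
    "('b multiset \<times> 'b multiset) set \<Rightarrow> 'b multiset set \<Rightarrow> 'b multiset set \<Rightarrow> 'b multiset set" where
  "class_add E A B = (\<Union>M\<in>A. \<Union>N\<in>B. E `` {M + N})"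

text \<open>
  The semigroup \<open>S\<close> is presented by its subset of generators \<open>G\<close> modulo the relations \<open>R\<close>: there is
  an isomorphism onto \<open>S\<close> from the quotient semigroup that sends the class of each generator to
  that generator.
\<close>

definition presented_by ::
    "'b::ab_semigroup_add set \<Rightarrow> 'b set \<Rightarrow> ('b multiset \<times> 'b multiset) set \<Rightarrow> bool" where
  "presented_by S G R \<longleftrightarrow>
     (let E = generated_congruence G R; Q = free_comm_semigroup G // E in
      \<exists>\<phi>. bij_betw \<phi> Q S
        \<and> (\<forall>A\<in>Q. \<forall>B\<in>Q. \<phi> (class_add E A B) = \<phi> A + \<phi> B)
        \<and> (\<forall>g\<in>G. \<phi> (E `` {{#g#}}) = g))"

definition polytope_semigroup ::
    "'a::euclidean_space set \<Rightarrow> 'a set \<Rightarrow> ('a set \<Rightarrow> 'a) \<Rightarrow> 'a set \<Rightarrow> ('a \<times> int) set" where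
  "polytope_semigroup \<Delta> P \<mu> \<sigma> = generated_semigroup (lattice_points \<Delta> P \<mu> \<sigma> \<times> {1})"

text \<open>The dilation $mP$ has vertices $m\mu_\sigma$, so $\Lambda(mP) = mP \cap (m\mu_\sigma + Y)$.\<close>

definition saturated_semigroup ::
    "'a::euclidean_space set \<Rightarrow> 'a set \<Rightarrow> ('a set \<Rightarrow> 'a) \<Rightarrow> 'a set \<Rightarrow> ('a \<times> int) set" where
  "saturated_semigroup \<Delta> P \<mu> \<sigma> =
     (\<Union>m\<in>{1::nat..}. lattice_points \<Delta> ((*\<^sub>R) (real m) ` P) (\<lambda>\<tau>. real m *\<^sub>R \<mu> \<tau>) \<sigma> \<times> {int m})"

definition quadratic_relations ::
    "'a::euclidean_space set \<Rightarrow> (('a \<times> int) multiset \<times> ('a \<times> int) multiset) set" where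
  "quadratic_relations L =
     {({#(x, 1), (y, 1)#}, {#(x', 1), (y', 1)#}) | x y x' y'.
        x \<in> L \<and> y \<in> L \<and> x' \<in> L \<and> y' \<in> L \<and> x + y = x' + y'}"

end

theory Submission imports Defs begin

text \<open>
  Everything rests on two properties of $\Lambda(P)$ for special $P$. A point of $\mu_\sigma + Y$ that is
  $\sigma$-dominant and $\le_\sigma \mu_\sigma$ lies in $\Lambda(P)$. And $y - \beta \in \Lambda(P)$ whenever
  $y \in \Lambda(P)$ and $\beta$ is a root with $(y, \beta) > 0$.

  A $\sigma$-dominant $z \in \Lambda(P + Q)$ can be raised by positive roots, through dominant points, up to the
  vertex, which splits. Descending again, each root can be subtracted from one of the two summands, hence
  $\Lambda(P + Q) = \Lambda(P) + \Lambda(Q)$, and $S_P$ is saturated.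

  For the quadratic relations it suffices that the set of all $y \in \Lambda(P)$ with
  $z - y \in \Lambda((m - 1) P)$ is connected under steps by roots. In a closest pair of points from different
  components both can be taken to be dominant, and raising one towards the other contradicts minimality.
\<close>

subsection \<open>Reflections and integer spans\<close>

text \<open>The polytope need not be invariant under the Weyl group, so a point cannot be reflected
  into a fixed chamber. Instead the chamber is chosen for the point: every vector is dominant for
  some chamber. Membership in the polytope is one condition per chamber, and dominance of the
  vertices is what carries such a condition across a wall. For the relations, a point
  \<open>y\<close> must respect two polytopes at once: a root that raises \<open>y\<close> inside
  the first may push \<open>z - y\<close> out of the second. The remedy is to keep a second point
  \<open>y'\<close> in view and to choose the root \<beta> with (\<beta>, \<beta>) \<le> (y' - y,
  \<beta>). This bound has two effects: moving either point by \<beta> towards the other shortens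
  their distance, and whenever \<open>y\<close> cannot be raised the bound fixes the signs that
  allow \<open>y'\<close> to be lowered.\<close>

lemma pairing_eq: "x \<bullet> coroot \<alpha> = 2 * (x \<bullet> \<alpha>) / (\<alpha> \<bullet> \<alpha>)"
  by (simp add: coroot_def)

lemma root_reflection_linear: "linear (root_reflection \<alpha>)"
  by (rule linearI) (auto simp: root_reflection_def inner_left_distrib algebra_simps)

lemma root_reflection_self [simp]: "root_reflection \<alpha> \<alpha> = - \<alpha>"
  by (cases "\<alpha> = 0") (auto simp: root_reflection_def coroot_def algebra_simps simp flip: scaleR_2)

lemma inner_root_reflection: "root_reflection \<alpha> x \<bullet> y = x \<bullet> root_reflection \<alpha> y"
  by (simp add: root_reflection_def coroot_def inner_diff_left inner_diff_right inner_commute)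

lemma root_reflection_involution [simp]: "root_reflection \<alpha> (root_reflection \<alpha> x) = x"
proof (cases "\<alpha> = 0")
  case True
  then show ?thesis by (simp add: root_reflection_def)
next
  case False
  have "root_reflection \<alpha> x \<bullet> coroot \<alpha> = - (x \<bullet> coroot \<alpha>)"
    using False by (simp add: root_reflection_def coroot_def inner_diff_left field_simps)
  then show ?thesis
    by (simp add: root_reflection_def[of _ "root_reflection \<alpha> x"]) (simp add: root_reflection_def)
qed

lemma integer_span_zero: "0 \<in> integer_span B"
  by (auto simp: integer_span_def intro!: exI[of _ "\<lambda>_. 0"])

lemma integer_span_add: "x \<in> integer_span B \<Longrightarrow> y \<in> integer_span B \<Longrightarrow> x + y \<in> integer_span B"
proof (clarsimp simp: integer_span_def)
  fix c d :: "'a \<Rightarrow> int"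
  show "\<exists>e. (\<Sum>b\<in>B. real_of_int (c b) *\<^sub>R b) + (\<Sum>b\<in>B. real_of_int (d b) *\<^sub>R b)
      = (\<Sum>b\<in>B. real_of_int (e b) *\<^sub>R b)"
    by (rule exI[of _ "\<lambda>b. c b + d b"]) (simp add: scaleR_left_distrib sum.distrib)
qed

lemma integer_span_scale: "x \<in> integer_span B \<Longrightarrow> of_int k *\<^sub>R x \<in> integer_span B"
proof (clarsimp simp: integer_span_def)
  fix c :: "'a \<Rightarrow> int"
  show "\<exists>e. real_of_int k *\<^sub>R (\<Sum>b\<in>B. real_of_int (c b) *\<^sub>R b) = (\<Sum>b\<in>B. real_of_int (e b) *\<^sub>R b)"
    by (rule exI[of _ "\<lambda>b. k * c b"]) (simp add: scaleR_sum_right)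
qed

lemma integer_span_uminus: "x \<in> integer_span B \<Longrightarrow> - x \<in> integer_span B"
  using integer_span_scale[of x B "-1"] by simp

lemma integer_span_diff: "x \<in> integer_span B \<Longrightarrow> y \<in> integer_span B \<Longrightarrow> x - y \<in> integer_span B"
  using integer_span_add[of x B "- y"] integer_span_uminus by auto

lemma integer_span_superset: "finite B \<Longrightarrow> b \<in> B \<Longrightarrow> b \<in> integer_span B"
  unfolding integer_span_def
  by (auto intro!: exI[of _ "\<lambda>x. if x = b then 1 else 0"]
      simp: if_distrib[of real_of_int] if_distrib[of "\<lambda>c. c *\<^sub>R _"] cong: if_cong)

subsection \<open>Root systems and bases\<close>

locale reduced_root_system =
  fixes \<Delta> :: "'a::euclidean_space set"
  assumes root_system: "root_system \<Delta>" and reduced: "reduced \<Delta>"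
begin

lemma finite_roots [simp]: "finite \<Delta>"
  and zero_not_root: "0 \<notin> \<Delta>"
  and span_roots: "span \<Delta> = UNIV"
  and reflection_root: "\<alpha> \<in> \<Delta> \<Longrightarrow> \<beta> \<in> \<Delta> \<Longrightarrow> root_reflection \<alpha> \<beta> \<in> \<Delta>"
  and pairing_roots: "\<alpha> \<in> \<Delta> \<Longrightarrow> \<beta> \<in> \<Delta> \<Longrightarrow> \<beta> \<bullet> coroot \<alpha> \<in> \<int>"
  using root_system unfolding root_system_def by blast+

lemma inner_root_self: "\<alpha> \<in> \<Delta> \<Longrightarrow> 0 < \<alpha> \<bullet> \<alpha>"
  using zero_not_root by auto

lemma pairing_pos_iff: "\<alpha> \<in> \<Delta> \<Longrightarrow> 0 < x \<bullet> coroot \<alpha> \<longleftrightarrow> 0 < x \<bullet> \<alpha>"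
  and pairing_neg_iff: "\<alpha> \<in> \<Delta> \<Longrightarrow> x \<bullet> coroot \<alpha> < 0 \<longleftrightarrow> x \<bullet> \<alpha> < 0"
  using inner_root_self[of \<alpha>]
  by (auto simp: pairing_eq zero_less_divide_iff divide_less_0_iff not_less[THEN iffD2, OF inner_ge_zero])

lemma uminus_root: "\<alpha> \<in> \<Delta> \<Longrightarrow> - \<alpha> \<in> \<Delta>"
  using reflection_root[of \<alpha> \<alpha>] by simp

text \<open>Both Cartan integers are positive. Were both at least 2, (\<alpha>, \<beta>) would be at
  least either squared length and \<alpha> - \<beta> would have norm 0. So one of them is 1, and the
  corresponding reflection produces the difference up to sign.\<close>

lemma diff_root:
  assumes \<alpha>: "\<alpha> \<in> \<Delta>" and \<beta>: "\<beta> \<in> \<Delta>" and pos: "\<alpha> \<bullet> \<beta> > 0" and ne: "\<alpha> \<noteq> \<beta>"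
  shows "\<alpha> - \<beta> \<in> \<Delta>"
proof -
  have p: "0 < \<alpha> \<bullet> \<alpha>" "0 < \<beta> \<bullet> \<beta>" using \<alpha> \<beta> inner_root_self by auto
  obtain k l :: int where k: "\<alpha> \<bullet> coroot \<beta> = of_int k" and l: "\<beta> \<bullet> coroot \<alpha> = of_int l"
    using pairing_roots \<alpha> \<beta> by (meson Ints_cases)
  have k0: "k > 0" and l0: "l > 0"
    using pairing_pos_iff[OF \<beta>, of \<alpha>] pairing_pos_iff[OF \<alpha>, of \<beta>] pos k l
    by (auto simp: inner_commute)
  have "k < 2 \<or> l < 2"
  proof (rule ccontr)
    assume "\<not> ?thesis"
    then have "real_of_int k \<ge> 2" "real_of_int l \<ge> 2" by auto
    moreover have "\<alpha> \<bullet> \<beta> = of_int k / 2 * (\<beta> \<bullet> \<beta>)" "\<alpha> \<bullet> \<beta> = of_int l / 2 * (\<alpha> \<bullet> \<alpha>)"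
      using p k l by (simp_all add: pairing_eq field_simps inner_commute)
    ultimately have "\<alpha> \<bullet> \<beta> \<ge> \<beta> \<bullet> \<beta>" "\<alpha> \<bullet> \<beta> \<ge> \<alpha> \<bullet> \<alpha>"
      using mult_right_mono[of 1 "of_int k / 2" "\<beta> \<bullet> \<beta>"] mult_right_mono[of 1 "of_int l / 2" "\<alpha> \<bullet> \<alpha>"]
      by simp_all
    then have "(\<alpha> - \<beta>) \<bullet> (\<alpha> - \<beta>) \<le> 0"
      by (simp add: inner_diff_left inner_diff_right inner_commute)
    then show False using ne
      by (metis inner_gt_zero_iff linorder_not_less right_minus_eq)
  qed
  then consider "k = 1" | "l = 1" using k0 l0 by linarith
  then show ?thesis
  proof cases
    case 1
    then show ?thesis using reflection_root[OF \<beta> \<alpha>] k by (simp add: root_reflection_def)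
  next
    case 2
    then show ?thesis using reflection_root[OF \<alpha> \<beta>] l uminus_root
      by (fastforce simp: root_reflection_def)
  qed
qed

lemma add_root:
  assumes "\<alpha> \<in> \<Delta>" "\<beta> \<in> \<Delta>" "\<alpha> \<bullet> \<beta> < 0" "\<alpha> \<noteq> - \<beta>"
  shows "\<alpha> + \<beta> \<in> \<Delta>"
  using diff_root[of \<alpha> "- \<beta>"] assms uminus_root by auto

text \<open>
  Chambers are indexed by the regular vectors \<open>\<rho>\<close> they contain. \<open>dom \<rho> x\<close> says that \<open>x\<close> is dominant,
  and \<open>above \<rho> v\<close> that \<open>v\<close> lies in the cone spanned by the positive roots, for the chamber of \<open>\<rho>\<close>.
\<close>

definition regular :: "'a \<Rightarrow> bool" where
  "regular \<rho> \<longleftrightarrow> (\<forall>\<alpha>\<in>\<Delta>. \<alpha> \<bullet> \<rho> \<noteq> 0)"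

definition pos :: "'a \<Rightarrow> 'a set" where
  "pos \<rho> = {\<alpha>\<in>\<Delta>. 0 < \<alpha> \<bullet> \<rho>}"

definition base :: "'a \<Rightarrow> 'a set" where
  "base \<rho> = {\<alpha>\<in>pos \<rho>. \<not> (\<exists>\<beta>\<in>pos \<rho>. \<exists>\<gamma>\<in>pos \<rho>. \<alpha> = \<beta> + \<gamma>)}"

definition coord :: "'a \<Rightarrow> 'a \<Rightarrow> 'a \<Rightarrow> real" where
  "coord \<rho> = representation (base \<rho>)"

definition height :: "'a \<Rightarrow> 'a \<Rightarrow> real" where
  "height \<rho> v = (\<Sum>a\<in>base \<rho>. coord \<rho> v a)"

definition dom :: "'a \<Rightarrow> 'a \<Rightarrow> bool" where
  "dom \<rho> x \<longleftrightarrow> (\<forall>\<alpha>\<in>pos \<rho>. 0 \<le> x \<bullet> \<alpha>)"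

definition above :: "'a \<Rightarrow> 'a \<Rightarrow> bool" where
  "above \<rho> v \<longleftrightarrow> (\<forall>a\<in>base \<rho>. 0 \<le> coord \<rho> v a)"

definition integral_wt :: "'a \<Rightarrow> bool" where
  "integral_wt x \<longleftrightarrow> (\<forall>\<alpha>\<in>\<Delta>. x \<bullet> coroot \<alpha> \<in> \<int>)"

section \<open>Simple roots as a basis, and coordinates in it\<close>

lemma pos_root: "\<alpha> \<in> pos \<rho> \<Longrightarrow> \<alpha> \<in> \<Delta>"
  and base_pos: "a \<in> base \<rho> \<Longrightarrow> a \<in> pos \<rho>"
  and base_root: "a \<in> base \<rho> \<Longrightarrow> a \<in> \<Delta>"
  by (auto simp: pos_def base_def)

lemma finite_pos [simp]: "finite (pos \<rho>)" and finite_base [simp]: "finite (base \<rho>)"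
  by (auto intro!: finite_subset[OF _ finite_roots] simp: pos_def base_def)

lemma pos_cases:
  assumes "regular \<rho>" "\<alpha> \<in> \<Delta>"
  obtains "\<alpha> \<in> pos \<rho>" "- \<alpha> \<notin> pos \<rho>" | "- \<alpha> \<in> pos \<rho>" "\<alpha> \<notin> pos \<rho>"
  using assms uminus_root[of \<alpha>] by (fastforce simp: regular_def pos_def)

lemma pos_uminus: "\<alpha> \<in> pos \<rho> \<Longrightarrow> - \<alpha> \<notin> pos \<rho>"
  by (auto simp: pos_def)

text \<open>With a positive product, \<open>a - b\<close> would be a root; whichever sign makes it
  positive, it decomposes one of the two simple roots.\<close>

lemma base_obtuse:
  assumes r: "regular \<rho>" and a: "a \<in> base \<rho>" and b: "b \<in> base \<rho>" and ne: "a \<noteq> b"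
  shows "a \<bullet> b \<le> 0"
proof (rule ccontr)
  assume "\<not> ?thesis"
  then have d: "a - b \<in> \<Delta>" using diff_root[of a b] a b ne base_root by auto
  have e: "a = b + (a - b)" "b = a + - (a - b)" by auto
  show False
    by (rule pos_cases[OF r d]) (use a b e base_pos in \<open>unfold base_def, blast\<close>)+
qed

text \<open>The values of roots on \<rho> are real, so the induction counts the positive roots with
  a smaller value.\<close>

lemma pos_nat_sum:
  assumes "\<beta> \<in> pos \<rho>"
  shows "\<exists>c::'a \<Rightarrow> nat. \<beta> = (\<Sum>a\<in>base \<rho>. real (c a) *\<^sub>R a)"
  using assms
proof (induction "card {\<gamma>\<in>pos \<rho>. \<gamma> \<bullet> \<rho> < \<beta> \<bullet> \<rho>}" arbitrary: \<beta> rule: less_induct)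
  case (less \<beta>)
  show ?case
  proof (cases "\<beta> \<in> base \<rho>")
    case True
    then have "\<beta> = (\<Sum>a\<in>base \<rho>. real (if a = \<beta> then 1 else 0) *\<^sub>R a)"
      by (simp add: if_distrib[of real] if_distrib[of "\<lambda>c. c *\<^sub>R _"] cong: if_cong)
    then show ?thesis by (rule exI[of _ "\<lambda>a. if a = \<beta> then 1 else 0"])
  next
    case False
    then obtain \<gamma> \<delta> where g: "\<gamma> \<in> pos \<rho>" "\<delta> \<in> pos \<rho>" "\<beta> = \<gamma> + \<delta>"
      using less.prems by (auto simp: base_def)
    then have lt: "\<gamma> \<bullet> \<rho> < \<beta> \<bullet> \<rho>" "\<delta> \<bullet> \<rho> < \<beta> \<bullet> \<rho>" by (auto simp: pos_def inner_add_left)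
    have "card {x\<in>pos \<rho>. x \<bullet> \<rho> < \<gamma> \<bullet> \<rho>} < card {x\<in>pos \<rho>. x \<bullet> \<rho> < \<beta> \<bullet> \<rho>}"
      "card {x\<in>pos \<rho>. x \<bullet> \<rho> < \<delta> \<bullet> \<rho>} < card {x\<in>pos \<rho>. x \<bullet> \<rho> < \<beta> \<bullet> \<rho>}"
      by (rule psubset_card_mono; use lt g in force)+
    then obtain c d :: "'a \<Rightarrow> nat" where
      "\<gamma> = (\<Sum>a\<in>base \<rho>. real (c a) *\<^sub>R a)" "\<delta> = (\<Sum>a\<in>base \<rho>. real (d a) *\<^sub>R a)"
      using less.hyps g by meson
    then have "\<beta> = (\<Sum>a\<in>base \<rho>. real (c a + d a) *\<^sub>R a)"
      using g(3) by (simp add: scaleR_left_distrib sum.distrib)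
    then show ?thesis by (rule exI[of _ "\<lambda>a. c a + d a"])
  qed
qed

text \<open>Separating the coefficients of a dependency by sign gives p = n, two nonnegative
  combinations with disjoint supports. Obtuse angles make (p, p) = (p, n) nonpositive, so both
  vanish; as simple roots are positive on \<rho>, so do all coefficients.\<close>

lemma independent_base:
  assumes r: "regular \<rho>"
  shows "independent (base \<rho>)"
proof
  assume "dependent (base \<rho>)"
  then obtain u where u: "(\<Sum>a\<in>base \<rho>. u a *\<^sub>R a) = 0" "\<exists>a\<in>base \<rho>. u a \<noteq> 0"
    unfolding dependent_finite[OF finite_base] by blast
  define p where "p = (\<Sum>a\<in>base \<rho>. max (u a) 0 *\<^sub>R a)"
  define n where "n = (\<Sum>a\<in>base \<rho>. max (- u a) 0 *\<^sub>R a)"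
  have "p - n = (\<Sum>a\<in>base \<rho>. u a *\<^sub>R a)"
    unfolding p_def n_def sum_subtractf[symmetric]
    by (rule sum.cong) (auto simp: max_def algebra_simps simp flip: scaleR_diff_left)
  then have pn: "p = n" using u by simp
  have "p \<bullet> n = (\<Sum>b\<in>base \<rho>. \<Sum>a\<in>base \<rho>. (max (u a) 0 * max (- u b) 0) * (a \<bullet> b))"
    unfolding p_def n_def by (simp add: inner_sum_left inner_sum_right sum_distrib_left mult_ac)
  also have "\<dots> \<le> 0"
  proof (intro sum_nonpos)
    fix b a assume ab: "b \<in> base \<rho>" "a \<in> base \<rho>"
    show "max (u a) 0 * max (- u b) 0 * (a \<bullet> b) \<le> 0"
    proof (cases "a = b")
      case False
      then show ?thesis using base_obtuse[OF r ab(2,1)] by (simp add: mult_nonneg_nonpos)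
    qed (auto simp: max_def)
  qed
  finally have p0: "p = 0" using pn by (metis inner_gt_zero_iff linorder_not_less)
  have "a \<bullet> \<rho> > 0" if "a \<in> base \<rho>" for a using that by (auto simp: base_def pos_def)
  moreover have "p \<bullet> \<rho> = (\<Sum>a\<in>base \<rho>. max (u a) 0 * (a \<bullet> \<rho>))"
    "n \<bullet> \<rho> = (\<Sum>a\<in>base \<rho>. max (- u a) 0 * (a \<bullet> \<rho>))"
    by (simp_all add: p_def n_def inner_sum_left)
  ultimately have "\<forall>a\<in>base \<rho>. max (u a) 0 * (a \<bullet> \<rho>) = 0" "\<forall>a\<in>base \<rho>. max (- u a) 0 * (a \<bullet> \<rho>) = 0"
    using p0 pn sum_nonneg_eq_0_iff[OF finite_base, of \<rho> "\<lambda>a. max (u a) 0 * (a \<bullet> \<rho>)"]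
      sum_nonneg_eq_0_iff[OF finite_base, of \<rho> "\<lambda>a. max (- u a) 0 * (a \<bullet> \<rho>)"]
    by (simp_all add: less_imp_le)
  then have "\<forall>a\<in>base \<rho>. u a = 0"
    using \<open>\<And>a. a \<in> base \<rho> \<Longrightarrow> a \<bullet> \<rho> > 0\<close> by (force simp: max_def split: if_splits)
  then show False using u by blast
qed

lemma span_base_UNIV:
  assumes r: "regular \<rho>"
  shows "span (base \<rho>) = UNIV"
proof -
  have p: "\<beta> \<in> span (base \<rho>)" if b: "\<beta> \<in> pos \<rho>" for \<beta>
  proof -
    obtain c :: "'a \<Rightarrow> nat" where c: "\<beta> = (\<Sum>a\<in>base \<rho>. real (c a) *\<^sub>R a)"
      using pos_nat_sum[OF b] by blast
    show ?thesis unfolding c by (intro span_sum span_scale span_base)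
  qed
  have "\<Delta> \<subseteq> span (base \<rho>)"
  proof
    fix \<beta> assume "\<beta> \<in> \<Delta>"
    then show "\<beta> \<in> span (base \<rho>)"
      by (rule pos_cases[OF r]) (use p span_neg[of "- \<beta>"] in auto)
  qed
  then show ?thesis using span_roots span_minimal[OF _ subspace_span] by blast
qed

lemma sum_coord: "regular \<rho> \<Longrightarrow> (\<Sum>a\<in>base \<rho>. coord \<rho> v a *\<^sub>R a) = v"
  using real_vector.sum_representation_eq[OF independent_base, of \<rho> v "base \<rho>"] span_base_UNIV
  by (simp add: coord_def)

lemma coord_unique:
  assumes r: "regular \<rho>" and v: "v = (\<Sum>a\<in>base \<rho>. c a *\<^sub>R a)" and a: "a \<in> base \<rho>"
  shows "coord \<rho> v a = c a"
proof -
  have "(\<Sum>a\<in>base \<rho>. (coord \<rho> v a - c a) *\<^sub>R a) = 0"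
    unfolding scaleR_left_diff_distrib sum_subtractf sum_coord[OF r] v[symmetric] by simp
  then have "\<forall>a\<in>base \<rho>. coord \<rho> v a - c a = 0"
    using independent_base[OF r] dependent_finite[OF finite_base, of \<rho>]
    by (auto dest: spec[of _ "\<lambda>a. coord \<rho> v a - c a"])
  then show ?thesis using a by simp
qed

lemma coord_add: "regular \<rho> \<Longrightarrow> coord \<rho> (v + w) a = coord \<rho> v a + coord \<rho> w a"
  and coord_diff: "regular \<rho> \<Longrightarrow> coord \<rho> (v - w) a = coord \<rho> v a - coord \<rho> w a"
  and coord_scale: "regular \<rho> \<Longrightarrow> coord \<rho> (c *\<^sub>R v) a = c * coord \<rho> v a"
  and coord_uminus: "regular \<rho> \<Longrightarrow> coord \<rho> (- v) a = - coord \<rho> v a"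
  and coord_zero: "coord \<rho> 0 a = 0"
  using independent_base[of \<rho>] span_base_UNIV[of \<rho>]
  by (simp_all add: coord_def real_vector.representation_add real_vector.representation_diff
      real_vector.representation_scale real_vector.representation_neg real_vector.representation_zero)

lemma coord_base: "regular \<rho> \<Longrightarrow> a \<in> base \<rho> \<Longrightarrow> coord \<rho> a b = (if b = a then 1 else 0)"
  using independent_base[of \<rho>] by (simp add: coord_def real_vector.representation_basis)

lemmas coord_simps = coord_add coord_diff coord_scale coord_uminus coord_zero coord_base

lemma height_add: "regular \<rho> \<Longrightarrow> height \<rho> (v + w) = height \<rho> v + height \<rho> w"
  and height_diff: "regular \<rho> \<Longrightarrow> height \<rho> (v - w) = height \<rho> v - height \<rho> w"
  and height_scale: "regular \<rho> \<Longrightarrow> height \<rho> (c *\<^sub>R v) = c * height \<rho> v"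
  and height_base: "regular \<rho> \<Longrightarrow> a \<in> base \<rho> \<Longrightarrow> height \<rho> a = 1"
  by (simp_all add: height_def coord_simps sum.distrib sum_subtractf sum_distrib_left)

lemma coord_pos_root:
  assumes "regular \<rho>" "\<beta> \<in> pos \<rho>" "a \<in> base \<rho>"
  shows "coord \<rho> \<beta> a \<in> \<int>" "0 \<le> coord \<rho> \<beta> a"
proof -
  obtain c :: "'a \<Rightarrow> nat" where "\<beta> = (\<Sum>a\<in>base \<rho>. real (c a) *\<^sub>R a)" using pos_nat_sum assms by blast
  then have "coord \<rho> \<beta> a = real (c a)" by (rule coord_unique[OF assms(1) _ assms(3)])
  then show "coord \<rho> \<beta> a \<in> \<int>" "0 \<le> coord \<rho> \<beta> a" by auto
qed

lemma above_pos: "regular \<rho> \<Longrightarrow> \<beta> \<in> pos \<rho> \<Longrightarrow> above \<rho> \<beta>"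
  by (simp add: above_def coord_pos_root)

lemma above_add: "regular \<rho> \<Longrightarrow> above \<rho> v \<Longrightarrow> above \<rho> w \<Longrightarrow> above \<rho> (v + w)"
  and above_scale: "regular \<rho> \<Longrightarrow> above \<rho> v \<Longrightarrow> 0 \<le> c \<Longrightarrow> above \<rho> (c *\<^sub>R v)"
  and above_zero: "above \<rho> 0"
  by (simp_all add: above_def coord_simps)

lemma above_sum:
  assumes "regular \<rho>" "\<And>i. i \<in> I \<Longrightarrow> above \<rho> (f i)"
  shows "above \<rho> (sum f I)"
  using assms(2) by (induction I rule: infinite_finite_induct) (auto simp: above_zero above_add assms(1))

lemma root_lattice_root: "\<beta> \<in> \<Delta> \<Longrightarrow> \<beta> \<in> root_lattice \<Delta>"
  by (simp add: root_lattice_def integer_span_superset)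

lemmas root_lattice_closed =
  integer_span_zero[of \<Delta>, folded root_lattice_def]
  integer_span_add[of _ \<Delta>, folded root_lattice_def]
  integer_span_diff[of _ \<Delta>, folded root_lattice_def]
  integer_span_uminus[of _ \<Delta>, folded root_lattice_def]
  integer_span_scale[of _ \<Delta>, folded root_lattice_def]

lemma coord_root_Ints:
  assumes "regular \<rho>" "\<beta> \<in> \<Delta>" "a \<in> base \<rho>"
  shows "coord \<rho> \<beta> a \<in> \<int>"
proof (rule pos_cases[OF assms(1,2)])
  assume "- \<beta> \<in> pos \<rho>"
  from coord_pos_root(1)[OF assms(1) this assms(3)] show ?thesis
    by (simp add: coord_uminus assms(1))
qed (use coord_pos_root(1) assms in blast)

lemma coord_sum:
  assumes "regular \<rho>"
  shows "coord \<rho> (sum f I) a = (\<Sum>i\<in>I. coord \<rho> (f i) a)"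
  by (induction I rule: infinite_finite_induct) (auto simp: coord_simps assms)

lemma coord_lattice_Ints:
  assumes "regular \<rho>" "v \<in> root_lattice \<Delta>" "a \<in> base \<rho>"
  shows "coord \<rho> v a \<in> \<int>"
proof -
  obtain c :: "'a \<Rightarrow> int" where "v = (\<Sum>b\<in>\<Delta>. of_int (c b) *\<^sub>R b)"
    using assms(2) by (auto simp: root_lattice_def integer_span_def)
  then show ?thesis
    by (auto simp: coord_sum coord_scale assms intro!: Ints_sum Ints_mult intro: coord_root_Ints)
qed

lemma integral_wt_add: "integral_wt x \<Longrightarrow> integral_wt y \<Longrightarrow> integral_wt (x + y)"
  and integral_wt_diff: "integral_wt x \<Longrightarrow> integral_wt y \<Longrightarrow> integral_wt (x - y)"
  and integral_wt_scale: "integral_wt x \<Longrightarrow> integral_wt (of_int k *\<^sub>R x)"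
  by (simp_all add: integral_wt_def inner_add_left inner_diff_left)

lemma integral_wt_lattice:
  assumes "v \<in> root_lattice \<Delta>"
  shows "integral_wt v"
proof -
  obtain c :: "'a \<Rightarrow> int" where "v = (\<Sum>b\<in>\<Delta>. of_int (c b) *\<^sub>R b)"
    using assms by (auto simp: root_lattice_def integer_span_def)
  then show ?thesis
    by (auto simp: integral_wt_def inner_sum_left intro!: Ints_sum Ints_mult intro: pairing_roots)
qed

lemma dom_base_iff:
  assumes "regular \<rho>"
  shows "dom \<rho> x \<longleftrightarrow> (\<forall>a\<in>base \<rho>. 0 \<le> x \<bullet> a)"
proof
  assume x: "\<forall>a\<in>base \<rho>. 0 \<le> x \<bullet> a"
  show "dom \<rho> x" unfolding dom_def
  proof
    fix \<beta> assume b: "\<beta> \<in> pos \<rho>"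
    have "x \<bullet> \<beta> = (\<Sum>a\<in>base \<rho>. coord \<rho> \<beta> a * (x \<bullet> a))"
      by (subst sum_coord[OF assms, of \<beta>, symmetric]) (simp add: inner_sum_right)
    also have "\<dots> \<ge> 0" using x coord_pos_root(2)[OF assms b] by (intro sum_nonneg) auto
    finally show "0 \<le> x \<bullet> \<beta>" .
  qed
qed (auto simp: dom_def base_pos)

lemma dom_above: "regular \<rho> \<Longrightarrow> dom \<rho> x \<Longrightarrow> above \<rho> v \<Longrightarrow> 0 \<le> x \<bullet> v"
  by (subst sum_coord[of \<rho> v, symmetric])
    (auto simp: inner_sum_right dom_def above_def base_pos intro!: sum_nonneg)

text \<open>A positive root without such a coordinate would be a multiple of \<open>a\<close>, and
  reducedness allows only the factors 1 and -1.\<close>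

lemma pos_multiple_base:
  assumes r: "regular \<rho>" and a: "a \<in> base \<rho>" and b: "\<beta> \<in> pos \<rho>" and ne: "\<beta> \<noteq> a"
  shows "\<exists>g\<in>base \<rho>. g \<noteq> a \<and> 0 < coord \<rho> \<beta> g"
proof (rule ccontr)
  assume "\<not> ?thesis"
  then have "\<And>g. g \<in> base \<rho> \<Longrightarrow> g \<noteq> a \<Longrightarrow> coord \<rho> \<beta> g = 0"
    using coord_pos_root(2)[OF r b] by force
  then have "(\<Sum>g\<in>base \<rho>. coord \<rho> \<beta> g *\<^sub>R g) = (\<Sum>g\<in>{a}. coord \<rho> \<beta> g *\<^sub>R g)"
    using a by (intro sum.mono_neutral_right) auto
  then have e: "\<beta> = coord \<rho> \<beta> a *\<^sub>R a" using sum_coord[OF r, of \<beta>] by simp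
  then have "coord \<rho> \<beta> a = 1 \<or> coord \<rho> \<beta> a = - 1"
    using reduced a b base_root pos_root unfolding reduced_def by metis
  then have "coord \<rho> \<beta> a = 1" using coord_pos_root(2)[OF r b a] by linarith
  then have "\<beta> = a" using e scaleR_one by metis
  then show False using ne by contradiction
qed

text \<open>The reflection changes only the coordinate at \<open>a\<close>. Another coordinate is
  positive and survives, and a single positive coordinate decides the sign of a root.\<close>

lemma reflection_pos:
  assumes r: "regular \<rho>" and a: "a \<in> base \<rho>" and b: "\<beta> \<in> pos \<rho>" and ne: "\<beta> \<noteq> a"
  shows "root_reflection a \<beta> \<in> pos \<rho>"
proof -
  obtain g where g: "g \<in> base \<rho>" "g \<noteq> a" "0 < coord \<rho> \<beta> g" using pos_multiple_base assms by blast
  have "coord \<rho> (root_reflection a \<beta>) g = coord \<rho> \<beta> g"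
    using g a r by (simp add: root_reflection_def coord_simps)
  moreover have "root_reflection a \<beta> \<in> \<Delta>" using reflection_root a b base_root pos_root by blast
  ultimately show ?thesis
  proof -
    assume e: "coord \<rho> (root_reflection a \<beta>) g = coord \<rho> \<beta> g" and d: "root_reflection a \<beta> \<in> \<Delta>"
    show ?thesis
    proof (rule pos_cases[OF r d])
      assume "- root_reflection a \<beta> \<in> pos \<rho>"
      from coord_pos_root(2)[OF r this g(1)] show ?thesis using e g(3) by (simp add: coord_uminus r)
    qed
  qed
qed

section \<open>Reflections acting on chambers\<close>

lemma regular_reflection: "regular \<rho> \<Longrightarrow> a \<in> \<Delta> \<Longrightarrow> regular (root_reflection a \<rho>)"
  unfolding regular_def by (metis inner_root_reflection reflection_root)

lemma pos_reflection:
  assumes "a \<in> \<Delta>"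
  shows "pos (root_reflection a \<rho>) = root_reflection a ` pos \<rho>"
proof -
  have "\<beta> \<in> root_reflection a ` pos \<rho>" if "\<beta> \<in> pos (root_reflection a \<rho>)" for \<beta>
    using that assms reflection_root[of a \<beta>]
    by (intro image_eqI[of _ _ "root_reflection a \<beta>"]) (auto simp: pos_def inner_root_reflection)
  then show ?thesis
    using assms by (auto simp: pos_def inner_root_reflection reflection_root)
qed

lemma base_reflection:
  assumes "a \<in> \<Delta>"
  shows "base (root_reflection a \<rho>) = root_reflection a ` base \<rho>"
proof -
  let ?s = "root_reflection a"
  have inj: "?s x = ?s y \<longleftrightarrow> x = y" for x y by (metis root_reflection_involution)
  have "?s x = ?s y + ?s z \<longleftrightarrow> x = y + z" for x y z
    by (metis inj linear_add root_reflection_linear)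
  then show ?thesis unfolding base_def pos_reflection[OF assms] by (auto simp: inj)
qed

lemma pos_simple_reflection:
  assumes r: "regular \<rho>" and a: "a \<in> base \<rho>"
  shows "pos (root_reflection a \<rho>) = insert (- a) (pos \<rho> - {a})"
proof -
  have "root_reflection a ` (pos \<rho> - {a}) = pos \<rho> - {a}"
  proof -
    have "root_reflection a \<beta> \<in> pos \<rho> - {a}" if "\<beta> \<in> pos \<rho> - {a}" for \<beta>
      using reflection_pos[OF r a, of \<beta>] that pos_uminus[OF base_pos[OF a]]
      by (metis Diff_iff insertCI root_reflection_involution root_reflection_self singletonD)
    then show ?thesis
      by (auto intro!: image_eqI[of _ _ "root_reflection a _"])
  qed
  moreover have "pos \<rho> = insert a (pos \<rho> - {a})" using a base_pos by blast
  ultimately show ?thesis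
    using pos_reflection[OF base_root[OF a], of \<rho>]
    by (metis image_insert root_reflection_self)
qed

lemma uminus_base_reflection:
  "a \<in> base \<rho> \<Longrightarrow> - a \<in> base (root_reflection a \<rho>)"
  using base_reflection[OF base_root, of a \<rho> \<rho>] by (metis imageI root_reflection_self)

text \<open>The height of a fixed vector depends on the chamber; this lets
  \<open>descend_dominant\<close> lower the height of a root by changing the chamber instead of the
  root.\<close>

lemma height_reflection:
  assumes r: "regular \<rho>" and a: "a \<in> \<Delta>"
  shows "height (root_reflection a \<rho>) v = height \<rho> (root_reflection a v)"
proof -
  let ?s = "root_reflection a"
  have inj: "inj_on ?s A" for A by (metis inj_onI root_reflection_involution)
  have "v = ?s (\<Sum>b\<in>base \<rho>. coord \<rho> (?s v) b *\<^sub>R b)" by (simp add: sum_coord r)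
  also have "\<dots> = (\<Sum>b\<in>base \<rho>. coord \<rho> (?s v) b *\<^sub>R ?s b)"
    by (simp add: linear_sum[OF root_reflection_linear] linear_scale[OF root_reflection_linear])
  also have "\<dots> = (\<Sum>b\<in>base (?s \<rho>). coord \<rho> (?s v) (?s b) *\<^sub>R b)"
    by (simp add: base_reflection[OF a] sum.reindex[OF inj])
  finally have "coord (?s \<rho>) v b = coord \<rho> (?s v) (?s b)" if "b \<in> base (?s \<rho>)" for b
    by (rule coord_unique[OF regular_reflection[OF r a] _ that])
  then show ?thesis
    by (simp add: height_def base_reflection[OF a] sum.reindex[OF inj])
qed

lemma dom_reflection:
  assumes "a \<in> \<Delta>"
  shows "dom (root_reflection a \<rho>) x \<longleftrightarrow> dom \<rho> (root_reflection a x)"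
  by (auto simp: dom_def pos_reflection[OF assms] inner_root_reflection)

text \<open>Induction along a minimal gallery: each step passes from \<open>\<tau>\<close> to a chamber closer to that of \<open>\<rho>\<close>.\<close>

lemma gallery_induct [consumes 2, case_names start cross]:
  assumes r: "regular \<rho>" and t: "regular \<tau>"
    and start: "\<And>\<tau>. regular \<tau> \<Longrightarrow> pos \<tau> = pos \<rho> \<Longrightarrow> Q \<tau>"
    and cross: "\<And>\<tau> a. regular \<tau> \<Longrightarrow> a \<in> base \<tau> \<Longrightarrow> - a \<in> pos \<rho> \<Longrightarrow> Q (root_reflection a \<tau>) \<Longrightarrow> Q \<tau>"
  shows "Q \<tau>"
  using t
proof (induction "card (pos \<tau> - pos \<rho>)" arbitrary: \<tau> rule: less_induct)
  case (less \<tau>)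
  show ?case
  proof (cases "base \<tau> \<subseteq> pos \<rho>")
    \<comment> \<open>No simple root of \<tau> is negative on \<rho>, so \<rho> is dominant for
      \<tau>; being regular, it lies in the same chamber.\<close>
    case True
    have "pos \<tau> \<subseteq> pos \<rho>"
    proof
      fix \<beta> assume b: "\<beta> \<in> pos \<tau>"
      have "dom \<tau> \<rho>" using True less.prems
        by (auto simp: dom_base_iff pos_def inner_commute intro!: less_imp_le)
      then have "0 \<le> \<beta> \<bullet> \<rho>" using b by (simp add: dom_def inner_commute)
      then show "\<beta> \<in> pos \<rho>" using r b pos_root[OF b] by (force simp: regular_def pos_def)
    qed
    moreover have "pos \<rho> \<subseteq> pos \<tau>"
    proof
      fix \<beta> assume b: "\<beta> \<in> pos \<rho>"
      show "\<beta> \<in> pos \<tau>"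
        by (rule pos_cases[OF less.prems pos_root[OF b]]) (use calculation b pos_uminus in blast)+
    qed
    ultimately show ?thesis using start less.prems by blast
  next
    case False
    then obtain a where a: "a \<in> base \<tau>" "a \<notin> pos \<rho>" by blast
    then have na: "- a \<in> pos \<rho>" using pos_cases[OF r base_root] by blast
    have "pos (root_reflection a \<tau>) - pos \<rho> \<subset> pos \<tau> - pos \<rho>"
      using pos_simple_reflection[OF less.prems a(1)] a na base_pos by auto
    then have "card (pos (root_reflection a \<tau>) - pos \<rho>) < card (pos \<tau> - pos \<rho>)"
      by (intro psubset_card_mono) auto
    then show ?thesis
      using less.hyps regular_reflection less.prems a na cross base_root by metis
  qed
qed

end

lemma obtain_max_real:
  fixes f :: "'b \<Rightarrow> real"
  assumes "finite A" "A \<noteq> {}"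
  obtains x where "x \<in> A" "\<And>y. y \<in> A \<Longrightarrow> f y \<le> f x"
  using arg_min_if_finite[of A "\<lambda>x. - f x"] assms by fastforce

lemma Ints_pos_ge_1: "(x::real) \<in> \<int> \<Longrightarrow> 0 < x \<Longrightarrow> 1 \<le> x"
  by (auto elim!: Ints_cases)

lemma Ints_less_add_1: "(x::real) \<in> \<int> \<Longrightarrow> y \<in> \<int> \<Longrightarrow> x < y \<Longrightarrow> x + 1 \<le> y"
  using Ints_pos_ge_1[of "y - x"] by simp

context reduced_root_system
begin

text \<open>Distinct simple roots have nonpositive products, so every term of the expansion is
  nonpositive. It is mostly used in reverse: a positive product with \<open>a\<close> forces a
  positive coordinate there.\<close>

lemma inner_base_nonpos:
  assumes r: "regular \<rho>" and a: "a \<in> base \<rho>" and c: "coord \<rho> v a \<le> 0"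
    and o: "\<And>g. g \<in> base \<rho> \<Longrightarrow> g \<noteq> a \<Longrightarrow> 0 \<le> coord \<rho> v g"
  shows "v \<bullet> a \<le> 0"
proof -
  have "v \<bullet> a = (\<Sum>g\<in>base \<rho>. coord \<rho> v g * (g \<bullet> a))"
    by (subst sum_coord[OF r, of v, symmetric]) (simp add: inner_sum_left)
  also have "\<dots> \<le> 0"
  proof (rule sum_nonpos)
    fix g assume g: "g \<in> base \<rho>"
    show "coord \<rho> v g * (g \<bullet> a) \<le> 0"
      using c o[OF g] base_obtuse[OF r g a]
      by (cases "g = a") (auto simp: mult_nonpos_nonneg mult_nonneg_nonpos)
  qed
  finally show ?thesis .
qed

text \<open>The coordinate at \<open>a\<close> is positive and an integer, so it can spare
  1.\<close>

lemma above_diff_base: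
  assumes r: "regular \<rho>" and a: "a \<in> base \<rho>" and v: "v \<in> root_lattice \<Delta>" "above \<rho> v"
    and c: "0 < v \<bullet> a"
  shows "above \<rho> (v - a)"
proof -
  have "0 < coord \<rho> v a"
    using inner_base_nonpos[OF r a, of v] v(2) c by (force simp: above_def)
  then have "1 \<le> coord \<rho> v a" using coord_lattice_Ints[OF r v(1) a] Ints_pos_ge_1 by blast
  then show ?thesis using v(2) by (auto simp: above_def coord_simps r a)
qed

lemma height_pos_root:
  assumes r: "regular \<rho>" and b: "\<beta> \<in> pos \<rho>"
  shows "1 \<le> height \<rho> \<beta>"
proof -
  have "\<exists>g\<in>base \<rho>. 0 < coord \<rho> \<beta> g"
  proof (rule ccontr)
    assume "\<not> ?thesis"
    then have "\<forall>g\<in>base \<rho>. coord \<rho> \<beta> g = 0" using coord_pos_root(2)[OF r b] by force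
    then have "\<beta> = 0" using sum_coord[OF r, of \<beta>] by simp
    then show False using b zero_not_root pos_root by blast
  qed
  then obtain g where g: "g \<in> base \<rho>" "0 < coord \<rho> \<beta> g" by blast
  have "1 \<le> coord \<rho> \<beta> g" using g coord_pos_root(1)[OF r b] Ints_pos_ge_1 by blast
  also have "\<dots> \<le> height \<rho> \<beta>"
    unfolding height_def using coord_pos_root(2)[OF r b] g by (intro member_le_sum) auto
  finally show ?thesis .
qed

lemma regular_exists: "\<exists>\<rho>. regular \<rho>"
proof -
  have "negligible (\<Union>((\<lambda>\<alpha>. {v. \<alpha> \<bullet> v = 0}) ` \<Delta>))"
    using zero_not_root by (intro negligible_Union) (auto intro: negligible_hyperplane)
  then have "(\<Union>((\<lambda>\<alpha>. {v. \<alpha> \<bullet> v = 0}) ` \<Delta>)) \<noteq> UNIV" using non_negligible_UNIV by metis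
  then show ?thesis by (auto simp: regular_def)
qed

text \<open>A small push along a regular vector moves \<open>x\<close> off all walls while roots
  that are nonzero on \<open>x\<close> keep their sign. This takes the place of transitivity of the
  Weyl group on chambers.\<close>

lemma dom_exists: "\<exists>\<rho>. regular \<rho> \<and> dom \<rho> x"
proof -
  obtain \<rho> where r: "regular \<rho>" using regular_exists by blast
  have "\<forall>\<^sub>F e in at_right (0::real). \<alpha> \<bullet> (x + e *\<^sub>R \<rho>) \<noteq> 0 \<and> (0 < \<alpha> \<bullet> (x + e *\<^sub>R \<rho>) \<longrightarrow> 0 \<le> x \<bullet> \<alpha>)"
    if "\<alpha> \<in> \<Delta>" for \<alpha>
  proof -
    have t: "((\<lambda>e. \<alpha> \<bullet> (x + e *\<^sub>R \<rho>)) \<longlongrightarrow> \<alpha> \<bullet> (x + 0 *\<^sub>R \<rho>)) (at_right (0::real))"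
      by (intro tendsto_intros)
    consider "\<alpha> \<bullet> x > 0" | "\<alpha> \<bullet> x < 0" | "\<alpha> \<bullet> x = 0" by linarith
    then show ?thesis
    proof cases
      case 1
      then show ?thesis using order_tendstoD(1)[OF t, of 0]
        by (auto elim!: eventually_mono simp: inner_commute)
    next
      case 2
      then show ?thesis using order_tendstoD(2)[OF t, of 0]
        by (auto elim!: eventually_mono simp: inner_commute)
    next
      case 3
      have "\<forall>\<^sub>F e in at_right (0::real). 0 < e" by (simp add: eventually_at_right_less)
      then show ?thesis using 3 r that
        by (auto elim!: eventually_mono simp: inner_commute inner_add_right inner_add_left regular_def)
    qed
  qed
  then have "\<forall>\<^sub>F e in at_right (0::real). \<forall>\<alpha>\<in>\<Delta>.
      \<alpha> \<bullet> (x + e *\<^sub>R \<rho>) \<noteq> 0 \<and> (0 < \<alpha> \<bullet> (x + e *\<^sub>R \<rho>) \<longrightarrow> 0 \<le> x \<bullet> \<alpha>)"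
    by (intro eventually_ball_finite) auto
  then obtain e where "\<forall>\<alpha>\<in>\<Delta>. \<alpha> \<bullet> (x + e *\<^sub>R \<rho>) \<noteq> 0 \<and> (0 < \<alpha> \<bullet> (x + e *\<^sub>R \<rho>) \<longrightarrow> 0 \<le> x \<bullet> \<alpha>)"
    using eventually_happens'[OF trivial_limit_at_right_real] by blast
  then show ?thesis by (auto simp: regular_def dom_def pos_def intro!: exI[of _ "x + e *\<^sub>R \<rho>"])
qed

subsection \<open>Vertex systems\<close>

text \<open>
  The data of a special ample polytope, with $r \ge 0$ instead of $r > 0$: this makes the notion
  closed under sums and under all dilations, including the one by $0$.
\<close>

definition vertex_system :: "('a \<Rightarrow> 'a) \<Rightarrow> bool" where
  "vertex_system M \<longleftrightarrow>
     (\<forall>\<rho>. regular \<rho> \<longrightarrow> integral_wt (M \<rho>) \<and> dom \<rho> (M \<rho>) \<and>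
        (\<forall>a\<in>base \<rho>. \<exists>r::int. 0 \<le> r \<and> M \<rho> - M (root_reflection a \<rho>) = of_int r *\<^sub>R a)) \<and>
     (\<forall>\<rho> \<tau>. regular \<rho> \<longrightarrow> regular \<tau> \<longrightarrow> pos \<rho> = pos \<tau> \<longrightarrow> M \<rho> = M \<tau>)"

text \<open>$\Lambda(P)$, for the polytope cut out by the inequalities at the vertices \<open>M \<rho>\<close>.\<close>

definition Lam :: "('a \<Rightarrow> 'a) \<Rightarrow> 'a set" where
  "Lam M = {x. \<forall>\<rho>. regular \<rho> \<longrightarrow> M \<rho> - x \<in> root_lattice \<Delta> \<and> above \<rho> (M \<rho> - x)}"

lemma LamD:
  assumes "x \<in> Lam M" "regular \<rho>"
  shows "M \<rho> - x \<in> root_lattice \<Delta>" "above \<rho> (M \<rho> - x)"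
  using assms by (auto simp: Lam_def)

lemma Lam_diff_lattice:
  assumes "x \<in> Lam M" "y \<in> Lam M"
  shows "x - y \<in> root_lattice \<Delta>"
proof -
  obtain \<rho> where "regular \<rho>" using regular_exists by blast
  then have "(M \<rho> - y) - (M \<rho> - x) \<in> root_lattice \<Delta>"
    by (intro root_lattice_closed(3) LamD(1) assms)
  then show ?thesis by simp
qed

lemma vertex_systemD:
  assumes "vertex_system M" "regular \<rho>"
  shows "integral_wt (M \<rho>)" "dom \<rho> (M \<rho>)"
    and "a \<in> base \<rho> \<Longrightarrow> \<exists>r::int. 0 \<le> r \<and> M \<rho> - M (root_reflection a \<rho>) = of_int r *\<^sub>R a"
    and "regular \<tau> \<Longrightarrow> pos \<tau> = pos \<rho> \<Longrightarrow> M \<tau> = M \<rho>"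
  using assms unfolding vertex_system_def by blast+

lemma vertex_system_add:
  assumes M: "vertex_system M" and N: "vertex_system N"
  shows "vertex_system (\<lambda>\<rho>. M \<rho> + N \<rho>)"
  unfolding vertex_system_def
proof (intro conjI allI impI ballI)
  fix \<rho> a assume r: "regular \<rho>" and a: "a \<in> base \<rho>"
  obtain k l :: int where "0 \<le> k" "M \<rho> - M (root_reflection a \<rho>) = of_int k *\<^sub>R a"
    "0 \<le> l" "N \<rho> - N (root_reflection a \<rho>) = of_int l *\<^sub>R a"
    using vertex_systemD(3)[OF M r a] vertex_systemD(3)[OF N r a] by blast
  then have "0 \<le> k + l \<and> (M \<rho> + N \<rho>) - (M (root_reflection a \<rho>) + N (root_reflection a \<rho>))
      = of_int (k + l) *\<^sub>R a"
    by (simp add: scaleR_left_distrib flip: \<open>M \<rho> - _ = _\<close> \<open>N \<rho> - _ = _\<close>)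
  then show "\<exists>r\<ge>0. M \<rho> + N \<rho> - (M (root_reflection a \<rho>) + N (root_reflection a \<rho>)) = of_int r *\<^sub>R a"
    by blast
next
  fix \<rho> \<tau> assume *: "regular \<rho>" "regular \<tau>" "pos \<rho> = pos \<tau>"
  show "M \<rho> + N \<rho> = M \<tau> + N \<tau>"
    using vertex_systemD(4)[OF M *(2,1,3)] vertex_systemD(4)[OF N *(2,1,3)] by simp
qed (use vertex_systemD(1,2)[OF M] vertex_systemD(1,2)[OF N] in
    \<open>auto simp: integral_wt_add dom_def inner_add_left\<close>)

lemma vertex_system_scale:
  assumes M: "vertex_system M"
  shows "vertex_system (\<lambda>\<rho>. real m *\<^sub>R M \<rho>)"
  unfolding vertex_system_def
proof (intro conjI allI impI ballI)
  fix \<rho> a assume r: "regular \<rho>" and a: "a \<in> base \<rho>"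
  obtain k :: int where k: "0 \<le> k" "M \<rho> - M (root_reflection a \<rho>) = of_int k *\<^sub>R a"
    using vertex_systemD(3)[OF M r a] by blast
  have "0 \<le> int m * k \<and> real m *\<^sub>R M \<rho> - real m *\<^sub>R M (root_reflection a \<rho>) = of_int (int m * k) *\<^sub>R a"
    using k by (simp flip: scaleR_diff_right)
  then show "\<exists>r\<ge>0. real m *\<^sub>R M \<rho> - real m *\<^sub>R M (root_reflection a \<rho>) = of_int r *\<^sub>R a"
    by blast
next
  fix \<rho> assume "regular \<rho>"
  then show "integral_wt (real m *\<^sub>R M \<rho>)"
    using integral_wt_scale[of "M \<rho>" "int m"] vertex_systemD(1)[OF M] by simp
next
  fix \<rho> \<tau> assume "regular \<rho>" "regular \<tau>" "pos \<rho> = pos \<tau>"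
  then show "real m *\<^sub>R M \<rho> = real m *\<^sub>R M \<tau>" using vertex_systemD(4)[OF M, of \<tau> \<rho>] by simp
qed (use vertex_systemD(2)[OF M] in \<open>auto simp: dom_def\<close>)

text \<open>Every wall crossed on the way from \<rho> to \<tau> adds a nonnegative integer multiple
  of a root that is positive for \<rho>.\<close>

lemma vertex_diff:
  assumes M: "vertex_system M" and r: "regular \<rho>" and t: "regular \<tau>"
  shows "M \<rho> - M \<tau> \<in> root_lattice \<Delta> \<and> above \<rho> (M \<rho> - M \<tau>)"
  using r t
proof (induction \<tau> rule: gallery_induct)
  case (start \<tau>)
  then show ?case using vertex_systemD(4)[OF M r, of \<tau>]
    by (simp add: above_zero root_lattice_closed)
next
  case (cross \<tau> a)
  obtain k :: int where k: "0 \<le> k" "M \<tau> - M (root_reflection a \<tau>) = of_int k *\<^sub>R a"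
    using vertex_systemD(3)[OF M cross(1,2)] by blast
  have e: "M \<rho> - M \<tau> = (M \<rho> - M (root_reflection a \<tau>)) + of_int k *\<^sub>R (- a)"
    using k(2) by (simp add: algebra_simps)
  have "of_int k *\<^sub>R (- a) \<in> root_lattice \<Delta>"
    using cross(3) pos_root by (intro root_lattice_closed root_lattice_root)
  moreover have "above \<rho> (of_int k *\<^sub>R (- a))"
    by (intro above_scale above_pos r cross(3)) (simp add: k(1))
  ultimately show ?case
    unfolding e using cross.IH by (blast intro: above_add[OF r] root_lattice_closed(2))
qed

lemma vertex_in_Lam: "vertex_system M \<Longrightarrow> regular \<tau> \<Longrightarrow> M \<tau> \<in> Lam M"
  using vertex_diff by (simp add: Lam_def)

lemma integral_wt_Lam:
  assumes M: "vertex_system M" and x: "x \<in> Lam M"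
  shows "integral_wt x"
proof -
  obtain \<rho> where r: "regular \<rho>" using regular_exists by blast
  have "integral_wt (M \<rho> - (M \<rho> - x))"
    by (intro integral_wt_diff integral_wt_lattice LamD(1)[OF x r] vertex_systemD(1)[OF M r])
  then show ?thesis by simp
qed

lemma pairing_Lam:
  "vertex_system M \<Longrightarrow> x \<in> Lam M \<Longrightarrow> \<alpha> \<in> \<Delta> \<Longrightarrow> x \<bullet> coroot \<alpha> \<in> \<int>"
  using integral_wt_Lam by (auto simp: integral_wt_def)

text \<open>
  Crossing a wall adds to \<open>E\<close>, a combination of positive roots other than \<open>a\<close>, a multiple $-ua$.
  Dominance of the vertex bounds $u$ by half the pairing of \<open>E\<close> with the coroot of \<open>a\<close>, so
  $E - ua$ lies on the segment from \<open>E\<close> to its reflection, and both ends are positive.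
\<close>

lemma dominant_above_cross:
  assumes M: "vertex_system M" and t: "regular \<tau>" and a: "a \<in> base \<tau>" and y: "y \<bullet> a \<le> 0"
    and IH: "above (root_reflection a \<tau>) (M (root_reflection a \<tau>) - y)"
  shows "above \<tau> (M \<tau> - y)"
proof -
  define \<tau>' where "\<tau>' = root_reflection a \<tau>"
  define D where "D = M \<tau>' - y"
  define c where "c = coord \<tau>' D"
  define E where "E = (\<Sum>g\<in>base \<tau>' - {- a}. c g *\<^sub>R g)"
  have t': "regular \<tau>'" using regular_reflection[OF t base_root[OF a]] by (simp add: \<tau>'_def)
  have na: "- a \<in> base \<tau>'" using uminus_base_reflection[OF a] by (simp add: \<tau>'_def)
  have c0: "0 \<le> c g" if "g \<in> base \<tau>'" for g
    using IH that by (simp add: above_def c_def D_def \<tau>'_def)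
  have g: "g \<in> pos \<tau> \<and> g \<noteq> a" if "g \<in> base \<tau>' - {- a}" for g
    using that base_pos[of g \<tau>'] pos_simple_reflection[OF t a] by (auto simp: \<tau>'_def)
  have D: "D = E - c (- a) *\<^sub>R a"
    using sum_coord[OF t', of D] by (simp add: E_def c_def sum.remove[OF _ na])
  have E: "above \<tau> E" "above \<tau> (root_reflection a E)"
    unfolding E_def linear_sum[OF root_reflection_linear] linear_scale[OF root_reflection_linear]
    by (intro above_sum above_scale above_pos t c0; use g reflection_pos[OF t a] in blast)+
  obtain r :: int where r: "0 \<le> r" "M \<tau> - M \<tau>' = of_int r *\<^sub>R a"
    using vertex_systemD(3)[OF M t a] by (auto simp: \<tau>'_def)
  define u where "u = c (- a) - of_int r"
  have e: "M \<tau> - y = E - u *\<^sub>R a"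
    using D r(2) by (simp add: D_def u_def algebra_simps)
  show ?thesis
  proof (cases "u \<le> 0")
    case True
    have "above \<tau> (E + (- u) *\<^sub>R a)"
      using True by (intro above_add above_scale above_pos E t base_pos a) auto
    then show ?thesis by (simp add: e)
  next
    case False
    have aa: "0 < a \<bullet> a" using inner_root_self base_root a by blast
    define p where "p = E \<bullet> coroot a"
    have "0 \<le> (M \<tau> - y) \<bullet> a"
      using vertex_systemD(2)[OF M t] a y base_pos by (force simp: dom_def inner_diff_left)
    then have "u * (a \<bullet> a) \<le> E \<bullet> a" by (simp add: e inner_diff_left)
    then have up: "2 * u \<le> p" using aa by (simp add: p_def pairing_eq field_simps)
    have "above \<tau> ((1 - u / p) *\<^sub>R E + (u / p) *\<^sub>R root_reflection a E)"
      using False up by (intro above_add above_scale E t) (auto simp: field_simps)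
    also have "(1 - u / p) *\<^sub>R E + (u / p) *\<^sub>R root_reflection a E = M \<tau> - y"
      using False up by (simp add: e root_reflection_def algebra_simps flip: p_def)
    finally show ?thesis .
  qed
qed

text \<open>At each wall of the gallery the simple root \<open>a\<close> is negative for \<rho>, so
  dominance of \<open>y\<close> gives (y, a) \<le> 0. That is the condition under which
  \<open>dominant_above_cross\<close> passes the inequality on, and at \<rho> itself it is
  given.\<close>

lemma dominant_in_Lam:
  assumes M: "vertex_system M" and r: "regular \<rho>" and y: "dom \<rho> y" "above \<rho> (M \<rho> - y)"
    and l: "M \<rho> - y \<in> root_lattice \<Delta>"
  shows "y \<in> Lam M"
  unfolding Lam_def
proof (intro CollectI allI impI conjI)
  fix \<tau> assume t: "regular \<tau>"
  have "(M \<tau> - M \<rho>) + (M \<rho> - y) \<in> root_lattice \<Delta>"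
    using vertex_diff[OF M t r] l by (intro root_lattice_closed(2)) auto
  then show "M \<tau> - y \<in> root_lattice \<Delta>" by simp
  show "above \<tau> (M \<tau> - y)"
    using r t
  proof (induction \<tau> rule: gallery_induct)
    case (start \<tau>)
    have "base \<tau> = base \<rho>" using start by (simp add: base_def)
    then show ?case using y(2) vertex_systemD(4)[OF M r start] by (simp add: above_def coord_def)
  next
    case (cross \<tau> a)
    then have "y \<bullet> a \<le> 0" using y(1) by (fastforce simp: dom_def)
    then show ?case by (rule dominant_above_cross[OF M cross(1,2) _ cross.IH])
  qed
qed

text \<open>With pairing 1, subtracting \<open>a\<close> is reflecting in \<open>a\<close>, so the
  new point is dominant across the wall and only that chamber has to be checked. There
  \<open>- a\<close> is simple, and it pairs nonnegatively with the vertex and negatively with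
  \<open>y\<close>, so the gap between them can spare one copy of it.\<close>

lemma descend_simple:
  assumes M: "vertex_system M" and r: "regular \<rho>" and y: "dom \<rho> y" "y \<in> Lam M"
    and a: "a \<in> base \<rho>" and p: "y \<bullet> coroot a = 1"
  shows "y - a \<in> Lam M" "dom (root_reflection a \<rho>) (y - a)"
proof -
  let ?\<rho>' = "root_reflection a \<rho>"
  have r': "regular ?\<rho>'" using regular_reflection[OF r base_root[OF a]] .
  have na: "- a \<in> base ?\<rho>'" by (rule uminus_base_reflection[OF a])
  have ya: "0 < y \<bullet> a" using pairing_pos_iff[OF base_root[OF a], of y] p by simp
  have s: "y - a = root_reflection a y" by (simp add: root_reflection_def p)
  show d: "dom ?\<rho>' (y - a)" using y(1) by (simp add: s dom_reflection base_root[OF a])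
  have "0 < (M ?\<rho>' - y) \<bullet> (- a)"
    using vertex_systemD(2)[OF M r'] base_pos[OF na] ya by (force simp: dom_def inner_diff_left)
  then have "above ?\<rho>' ((M ?\<rho>' - y) - (- a))"
    by (intro above_diff_base[OF r' na] LamD[OF y(2) r'])
  moreover have "(M ?\<rho>' - y) - (- a) \<in> root_lattice \<Delta>"
    by (intro root_lattice_closed(3) LamD(1)[OF y(2) r'] root_lattice_root base_root[OF na])
  ultimately show "y - a \<in> Lam M"
    using dominant_in_Lam[OF M r' d] by (simp add: algebra_simps)
qed

text \<open>
  Induction on the height of \<open>\<beta>\<close>. If $y - \beta$ is not dominant, some simple root \<open>a\<close> pairs more with
  \<open>\<beta>\<close> than with \<open>y\<close>. If \<open>a\<close> is orthogonal to \<open>y\<close>, then \<open>y\<close> is also dominant for the reflected chamber,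
  where \<open>\<beta>\<close> is lower; otherwise one subtracts first \<open>a\<close> and then $\beta - a$.
\<close>

lemma descend_dominant:
  assumes M: "vertex_system M"
  shows "regular \<rho> \<Longrightarrow> dom \<rho> y \<Longrightarrow> y \<in> Lam M \<Longrightarrow> \<beta> \<in> \<Delta> \<Longrightarrow> 0 < y \<bullet> \<beta> \<Longrightarrow>
    height \<rho> \<beta> \<le> real n \<Longrightarrow> y - \<beta> \<in> Lam M"
proof (induction n arbitrary: \<rho> y \<beta>)
  case (0 \<rho> y \<beta>)
  have "\<beta> \<in> pos \<rho>" by (rule pos_cases[OF 0(1,4)]) (use 0 in \<open>fastforce simp: dom_def\<close>)+
  then show ?case using height_pos_root[OF 0(1), of \<beta>] 0 by simp
next
  case (Suc n \<rho> y \<beta>)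
  note r = Suc.prems(1) and y = Suc.prems(2,3) and b = Suc.prems(4) and yb = Suc.prems(5)
  have bp: "\<beta> \<in> pos \<rho>" by (rule pos_cases[OF r b]) (use y yb in \<open>fastforce simp: dom_def\<close>)+
  show ?case
  proof (cases "dom \<rho> (y - \<beta>)")
    case True
    have e: "M \<rho> - (y - \<beta>) = (M \<rho> - y) + \<beta>" by simp
    have "above \<rho> (M \<rho> - (y - \<beta>))" "M \<rho> - (y - \<beta>) \<in> root_lattice \<Delta>"
      unfolding e by (intro above_add above_pos root_lattice_closed(2) root_lattice_root LamD[OF y(2) r] r bp b)+
    then show ?thesis by (rule dominant_in_Lam[OF M r True])
  next
    case False
    then obtain a where a: "a \<in> base \<rho>" and neg: "(y - \<beta>) \<bullet> a < 0"
      by (auto simp: dom_base_iff[OF r] not_le)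
    note ar = base_root[OF a]
    have aa: "0 < a \<bullet> a" using inner_root_self[OF ar] .
    define p where "p = y \<bullet> coroot a"
    define k where "k = \<beta> \<bullet> coroot a"
    have pZ: "p \<in> \<int>" and kZ: "k \<in> \<int>"
      using pairing_Lam[OF M y(2) ar] pairing_roots[OF ar b] by (auto simp: p_def k_def)
    have ya: "y \<bullet> a = p * (a \<bullet> a) / 2" and ba: "\<beta> \<bullet> a = k * (a \<bullet> a) / 2"
      using aa by (auto simp: p_def k_def pairing_eq)
    have p0: "0 \<le> p" using y(1) base_pos[OF a] aa by (auto simp: dom_def p_def pairing_eq)
    have "p < k" using neg aa by (simp add: inner_diff_left ya ba)
    then have pk: "p + 1 \<le> k" using Ints_less_add_1 pZ kZ by blast
    have r': "regular (root_reflection a \<rho>)" using regular_reflection[OF r ar] .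
    show ?thesis
    proof (cases "\<beta> = a")
      case True
      \<comment> \<open>Now 0 < p < k = 2 leaves only p = 1, the case of
        \<open>descend_simple\<close>.\<close>
      then have "k = 2" using aa by (simp add: k_def pairing_eq)
      moreover have "0 < p" using yb True pairing_pos_iff[OF ar] by (simp add: p_def)
      ultimately have "p = 1" using pk Ints_pos_ge_1[OF pZ] by linarith
      then show ?thesis using descend_simple(1)[OF M r y a] True by (simp add: p_def)
    next
      case ne: False
      have sb: "root_reflection a \<beta> = \<beta> - k *\<^sub>R a" by (simp add: root_reflection_def k_def)
      have sbp: "\<beta> - k *\<^sub>R a \<in> pos \<rho>" using reflection_pos[OF r a bp ne] by (simp add: sb)
      have hs: "height \<rho> (\<beta> - k *\<^sub>R a) = height \<rho> \<beta> - k"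
        by (simp add: height_diff height_scale height_base r a)
      have hk: "1 \<le> height \<rho> \<beta> - k" using height_pos_root[OF r sbp] hs by simp
      show ?thesis
      proof (cases "p = 0")
        case True
        then have "root_reflection a y = y" by (simp add: root_reflection_def p_def)
        then have "dom (root_reflection a \<rho>) y" using y(1) by (simp add: dom_reflection[OF ar])
        moreover have "height (root_reflection a \<rho>) \<beta> \<le> real n"
          using Suc.prems(6) pk True by (simp add: height_reflection[OF r ar] sb hs)
        ultimately show ?thesis by (intro Suc.IH[OF r' _ y(2) b yb])
      next
        case False
        then have p1: "1 \<le> p" using p0 Ints_pos_ge_1[OF pZ] by simp
        have k2: "2 \<le> k" using p1 pk by simp
        \<comment> \<open>The height of \<beta> is at least k + 1, hence at least 3, so the
          induction hypothesis covers \<open>a\<close>, whose height is 1.\<close>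
        have "y - a \<in> Lam M"
          using Suc.IH[OF r y ar] p1 aa hk k2 Suc.prems(6) by (simp add: ya height_base r a)
        moreover have "\<beta> - a \<in> \<Delta>" using diff_root[OF b ar _ ne] k2 aa by (simp add: ba)
        \<comment> \<open>The reflected root \<beta> - k a is positive, hence (y, \<beta>) is at
          least k (y, a). The product in question is then at least
          \<open>((k - 1) * (p - 1) + 1) * (a \<bullet> a) / 2\<close>.\<close>
        moreover have "0 < (y - a) \<bullet> (\<beta> - a)"
        proof -
          have "0 \<le> y \<bullet> (\<beta> - k *\<^sub>R a)" using y(1) sbp by (simp add: dom_def)
          then have "k * (p * (a \<bullet> a) / 2) \<le> y \<bullet> \<beta>" by (simp add: inner_diff_right ya)
          moreover have "(y - a) \<bullet> (\<beta> - a) = y \<bullet> \<beta> - p * (a \<bullet> a) / 2 - k * (a \<bullet> a) / 2 + a \<bullet> a"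
            unfolding ya[symmetric] ba[symmetric]
            by (simp add: inner_diff_right inner_diff_left inner_commute)
          moreover have "k * (a \<bullet> a) - a \<bullet> a \<le> k * (p * (a \<bullet> a)) - p * (a \<bullet> a)"
            using mult_right_mono[of "(k - 1) * 1" "(k - 1) * p" "a \<bullet> a"] mult_left_mono[of 1 p "k - 1"] p1 k2 aa
            by (simp add: algebra_simps)
          ultimately show ?thesis using aa by linarith
        qed
        \<comment> \<open>For p \<ge> 2 the point \<open>y - a\<close> is still dominant for \<rho>,
          and the height drops by 1. For p = 1 it is dominant for the reflected chamber, where
          \<beta> - a has height smaller by k - 1 than \<beta> has for \<rho>.\<close>
        moreover have "\<exists>\<tau>. regular \<tau> \<and> dom \<tau> (y - a) \<and> height \<tau> (\<beta> - a) \<le> real n"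
        proof (cases "p = 1")
          case True
          have "height (root_reflection a \<rho>) (\<beta> - a) = height \<rho> (\<beta> - k *\<^sub>R a + a)"
            by (simp add: height_reflection[OF r ar] linear_diff[OF root_reflection_linear] sb)
          also have "\<dots> \<le> real n"
            using Suc.prems(6) k2 by (simp add: height_add hs height_base r a)
          finally show ?thesis using descend_simple(2)[OF M r y a] True r' by (auto simp: p_def)
        next
          case False
          then have p2: "2 \<le> p" using p1 Ints_less_add_1[of 1 p] pZ by simp
          have "0 \<le> (y - a) \<bullet> g" if g: "g \<in> base \<rho>" for g
          proof (cases "g = a")
            case True
            then show ?thesis using p2 aa by (simp add: inner_diff_left ya)
          next
            case False
            then show ?thesis using base_obtuse[OF r a g] y(1) base_pos[OF g]
              by (force simp: inner_diff_left dom_def)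
          qed
          then have "dom \<rho> (y - a)" by (simp add: dom_base_iff[OF r])
          then show ?thesis using r Suc.prems(6) by (auto simp: height_diff height_base a)
        qed
        ultimately have "(y - a) - (\<beta> - a) \<in> Lam M" using Suc.IH[of _ "y - a" "\<beta> - a"] by blast
        then show ?thesis by simp
      qed
    qed
  qed
qed

lemma descend:
  assumes M: "vertex_system M" and y: "y \<in> Lam M" and b: "\<beta> \<in> \<Delta>" and yb: "0 < y \<bullet> \<beta>"
  shows "y - \<beta> \<in> Lam M"
proof -
  obtain \<rho> where r: "regular \<rho>" "dom \<rho> y" using dom_exists by blast
  obtain n where "height \<rho> \<beta> \<le> real n" using real_arch_simple by blast
  then show ?thesis by (rule descend_dominant[OF M r y b yb])
qed

lemma ascend:
  assumes "vertex_system M" "y \<in> Lam M" "\<beta> \<in> \<Delta>" "y \<bullet> \<beta> < 0"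
  shows "y + \<beta> \<in> Lam M"
  using descend[of M y "- \<beta>"] assms uminus_root by simp

end

subsection \<open>Sums of vertex systems\<close>

context reduced_root_system
begin

text \<open>The root is one of maximal height among those below the positive part of \<open>\<delta>\<close>.\<close>

lemma raise_initial:
  assumes r: "regular \<rho>" and d: "\<delta> \<in> root_lattice \<Delta>" and a0: "a0 \<in> base \<rho>" "0 < coord \<rho> \<delta> a0"
  obtains \<beta> where "\<beta> \<in> pos \<rho>" "\<beta> \<bullet> \<beta> \<le> \<delta> \<bullet> \<beta>"
    "\<And>g. g \<in> base \<rho> \<Longrightarrow> coord \<rho> \<beta> g \<le> max (coord \<rho> \<delta> g) 0"
proof -
  define B where "B = {\<beta>\<in>pos \<rho>. \<forall>g\<in>base \<rho>. coord \<rho> \<beta> g \<le> max (coord \<rho> \<delta> g) 0}"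
  have dZ: "coord \<rho> \<delta> g \<in> \<int>" if "g \<in> base \<rho>" for g using coord_lattice_Ints[OF r d that] .
  have "1 \<le> coord \<rho> \<delta> a0" using a0 dZ Ints_pos_ge_1 by blast
  then have "a0 \<in> B" using a0 base_pos by (auto simp: B_def coord_base r)
  then have "finite B" "B \<noteq> {}" by (auto simp: B_def)
  then obtain \<beta> where \<beta>: "\<beta> \<in> B" and max: "\<And>\<gamma>. \<gamma> \<in> B \<Longrightarrow> height \<rho> \<gamma> \<le> height \<rho> \<beta>"
    using obtain_max_real by metis
  have bp: "\<beta> \<in> pos \<rho>" and bd: "\<And>g. g \<in> base \<rho> \<Longrightarrow> coord \<rho> \<beta> g \<le> max (coord \<rho> \<delta> g) 0"
    using \<beta> by (auto simp: B_def)
  \<comment> \<open>Where \<delta> exceeds \<beta>, a negative product would make \<beta> + g a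
    higher root of \<open>B\<close>. Where \<beta> exceeds \<delta>, the bound defining
    \<open>B\<close> forces \<beta> to have coordinate 0 at \<open>g\<close>, so its product with
    \<open>g\<close> is nonpositive.\<close>
  have "0 \<le> coord \<rho> (\<delta> - \<beta>) g * (g \<bullet> \<beta>)" if g: "g \<in> base \<rho>" for g
  proof -
    have b0: "0 \<le> coord \<rho> \<beta> g" and bZ: "coord \<rho> \<beta> g \<in> \<int>" using coord_pos_root[OF r bp g] by auto
    consider "coord \<rho> \<beta> g < coord \<rho> \<delta> g" | "coord \<rho> \<beta> g = coord \<rho> \<delta> g" | "coord \<rho> \<delta> g < coord \<rho> \<beta> g"
      by linarith
    then show ?thesis
    proof cases
      case 1
      have "0 \<le> g \<bullet> \<beta>"
      proof (rule ccontr)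
        assume n: "\<not> ?thesis"
        then have "\<beta> + g \<in> \<Delta>"
          using add_root[of \<beta> g] bp g base_pos pos_uminus[of \<beta> \<rho>]
          by (metis add.inverse_inverse base_root inner_commute not_le pos_root)
        then have "\<beta> + g \<in> pos \<rho>" using bp base_pos[OF g] by (auto simp: pos_def inner_add_left)
        moreover have "coord \<rho> \<beta> g + 1 \<le> coord \<rho> \<delta> g" using Ints_less_add_1 bZ dZ[OF g] 1 by blast
        ultimately have "\<beta> + g \<in> B" using bd by (auto simp: B_def coord_simps r g)
        then show False using max[of "\<beta> + g"] by (simp add: height_add height_base r g)
      qed
      then show ?thesis using 1 by (simp add: coord_simps r)
    next
      case 3
      then have "coord \<rho> \<beta> g = 0" using b0 bd[OF g] by linarith
      then have "\<beta> \<bullet> g \<le> 0"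
        using inner_base_nonpos[OF r g, of \<beta>] coord_pos_root(2)[OF r bp] by simp
      then show ?thesis using 3 by (simp add: coord_simps r inner_commute mult_nonpos_nonpos)
    qed (simp add: coord_simps r)
  qed
  then have "0 \<le> (\<Sum>g\<in>base \<rho>. coord \<rho> (\<delta> - \<beta>) g * (g \<bullet> \<beta>))" by (rule sum_nonneg)
  also have "\<dots> = (\<delta> - \<beta>) \<bullet> \<beta>"
    by (subst sum_coord[OF r, of "\<delta> - \<beta>", symmetric]) (simp add: inner_sum_left)
  finally show ?thesis using that[OF bp _ bd] by (simp add: inner_diff_left)
qed

text \<open>
  Here \<open>\<beta>\<close> has maximal height among the positive roots with $y + \beta \le M_\rho$ and
  $(\beta, \beta) \le (\delta, \beta)$. If $y + \beta$ were not dominant at \<open>a\<close>, then $\beta + a$ would be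
  another such root; the second condition survives because $y + \delta$ is dominant.
\<close>

lemma raise:
  assumes M: "vertex_system M" and r: "regular \<rho>"
    and y: "y \<in> Lam M" "dom \<rho> y" and y': "y' \<in> Lam M" "dom \<rho> y'"
    and a0: "a0 \<in> base \<rho>" "0 < coord \<rho> (y' - y) a0"
  obtains \<beta> where "\<beta> \<in> pos \<rho>" "\<beta> \<bullet> \<beta> \<le> (y' - y) \<bullet> \<beta>" "y + \<beta> \<in> Lam M" "dom \<rho> (y + \<beta>)"
proof -
  define \<delta> where "\<delta> = y' - y"
  define D where "D = M \<rho> - y"
  have D: "D \<in> root_lattice \<Delta>" "above \<rho> D" using LamD[OF y(1) r] by (auto simp: D_def)
  have D': "above \<rho> (D - \<delta>)" using LamD[OF y'(1) r] by (simp add: D_def \<delta>_def)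
  define B where "B = {\<beta>\<in>pos \<rho>. above \<rho> (D - \<beta>) \<and> \<beta> \<bullet> \<beta> \<le> \<delta> \<bullet> \<beta>}"
  obtain \<beta>0 where b0: "\<beta>0 \<in> pos \<rho>" "\<beta>0 \<bullet> \<beta>0 \<le> \<delta> \<bullet> \<beta>0"
    "\<And>g. g \<in> base \<rho> \<Longrightarrow> coord \<rho> \<beta>0 g \<le> max (coord \<rho> \<delta> g) 0"
    using raise_initial[OF r _ a0] Lam_diff_lattice[OF y'(1) y(1)] unfolding \<delta>_def by blast
  \<comment> \<open>Both \<open>y\<close> and \<open>y'\<close> lie below the vertex, so the
    coordinates of \<open>D\<close> dominate 0 and those of \<delta>, hence also their
    maximum.\<close>
  have "0 \<le> coord \<rho> (D - \<beta>0) g" if g: "g \<in> base \<rho>" for g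
    using b0(3)[OF g] D(2) D' g by (force simp: above_def coord_simps r)
  then have "\<beta>0 \<in> B" using b0 by (auto simp: B_def above_def)
  then have "finite B" "B \<noteq> {}" by (auto simp: B_def)
  then obtain \<beta> where \<beta>: "\<beta> \<in> B" and max: "\<And>\<gamma>. \<gamma> \<in> B \<Longrightarrow> height \<rho> \<gamma> \<le> height \<rho> \<beta>"
    using obtain_max_real by metis
  have bp: "\<beta> \<in> pos \<rho>" and bD: "above \<rho> (D - \<beta>)" and bd: "\<beta> \<bullet> \<beta> \<le> \<delta> \<bullet> \<beta>"
    using \<beta> by (auto simp: B_def)
  have lat: "D - \<beta> \<in> root_lattice \<Delta>"
    by (intro root_lattice_closed(3) D root_lattice_root pos_root[OF bp])
  have "0 \<le> (y + \<beta>) \<bullet> a" if a: "a \<in> base \<rho>" for a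
  proof (rule ccontr)
    assume neg: "\<not> ?thesis"
    note ar = base_root[OF a]
    have aa: "0 < a \<bullet> a" using inner_root_self[OF ar] .
    \<comment> \<open>The vertex is dominant, while y + \<beta> is negative on \<open>a\<close>; so
      there is room below the vertex for one more \<open>a\<close>.\<close>
    have "0 < (D - \<beta>) \<bullet> a"
      using vertex_systemD(2)[OF M r] neg base_pos[OF a]
      by (force simp: D_def dom_def inner_diff_left inner_add_left)
    then have ab: "above \<rho> (D - \<beta> - a)" using above_diff_base[OF r a lat bD] by blast
    define p where "p = y \<bullet> coroot a"
    define k where "k = - (\<beta> \<bullet> coroot a)"
    have pZ: "p \<in> \<int>" and kZ: "k \<in> \<int>"
      using pairing_Lam[OF M y(1) ar] pairing_roots[OF ar pos_root[OF bp]] by (auto simp: p_def k_def)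
    have ya: "y \<bullet> a = p * (a \<bullet> a) / 2" and ba: "\<beta> \<bullet> a = - k * (a \<bullet> a) / 2"
      using aa by (auto simp: p_def k_def pairing_eq)
    have p0: "0 \<le> p" using y(2) base_pos[OF a] aa by (auto simp: dom_def p_def pairing_eq)
    have "(p - k) * (a \<bullet> a) < 0" using neg by (simp add: inner_add_left ya ba algebra_simps)
    then have "p < k" using aa by (simp add: mult_less_0_iff)
    then have pk: "p + 1 \<le> k" using Ints_less_add_1 pZ kZ by blast
    have "\<beta> \<bullet> a < 0" using pk p0 aa by (simp add: ba)
    then have "\<beta> + a \<in> \<Delta>"
      using add_root[OF pos_root[OF bp] ar] bp pos_uminus[OF base_pos[OF a]] by blast
    then have "\<beta> + a \<in> pos \<rho>" using bp base_pos[OF a] by (auto simp: pos_def inner_add_left)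
    \<comment> \<open>Dominance of \<open>y'\<close> gives (\<delta>, a) \<ge> - (y, a). What
      remains is p + 2 \<le> 2 k, a consequence of p + 1 \<le> k and 0 \<le> p.\<close>
    moreover have "(\<beta> + a) \<bullet> (\<beta> + a) \<le> \<delta> \<bullet> (\<beta> + a)"
    proof -
      have "0 \<le> y' \<bullet> a" using y'(2) base_pos[OF a] by (simp add: dom_def)
      then have "- (p * (a \<bullet> a) / 2) \<le> \<delta> \<bullet> a" by (simp add: \<delta>_def inner_diff_left ya)
      moreover have "(\<beta> + a) \<bullet> (\<beta> + a) = \<beta> \<bullet> \<beta> - k * (a \<bullet> a) + a \<bullet> a"
        using ba by (simp add: inner_add_left inner_add_right inner_commute[of a \<beta>])
      moreover have "(p + 2) * (a \<bullet> a) \<le> (2 * k) * (a \<bullet> a)"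
        using aa pk p0 by (intro mult_right_mono) auto
      ultimately show ?thesis using bd by (simp add: inner_add_right algebra_simps)
    qed
    ultimately have "\<beta> + a \<in> B" using ab by (simp add: B_def algebra_simps)
    then show False using max[of "\<beta> + a"] by (simp add: height_add height_base r a)
  qed
  then have d: "dom \<rho> (y + \<beta>)" by (simp add: dom_base_iff[OF r])
  moreover have "y + \<beta> \<in> Lam M"
    using dominant_in_Lam[OF M r d] bD lat by (simp add: D_def algebra_simps)
  ultimately show ?thesis using that bp bd by (simp add: \<delta>_def)
qed

lemma Lam_add:
  assumes "x \<in> Lam M" "y \<in> Lam N"
  shows "x + y \<in> Lam (\<lambda>\<rho>. M \<rho> + N \<rho>)"
  unfolding Lam_def
proof (intro CollectI allI impI)
  fix \<rho> assume r: "regular \<rho>"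
  have e: "M \<rho> + N \<rho> - (x + y) = (M \<rho> - x) + (N \<rho> - y)" by simp
  show "M \<rho> + N \<rho> - (x + y) \<in> root_lattice \<Delta> \<and> above \<rho> (M \<rho> + N \<rho> - (x + y))"
    unfolding e by (intro conjI root_lattice_closed(2) above_add LamD[OF assms(1) r] LamD[OF assms(2) r] r)
qed

lemma Lam_sum_dominant:
  assumes M: "vertex_system M" and N: "vertex_system N" and r: "regular \<rho>"
  shows "z \<in> Lam (\<lambda>\<rho>. M \<rho> + N \<rho>) \<Longrightarrow> dom \<rho> z \<Longrightarrow> height \<rho> (M \<rho> + N \<rho> - z) \<le> real n \<Longrightarrow>
    \<exists>y\<in>Lam M. z - y \<in> Lam N"
proof (induction n arbitrary: z)
  case (0 z)
  have c: "\<forall>a\<in>base \<rho>. 0 \<le> coord \<rho> (M \<rho> + N \<rho> - z) a"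
    using LamD(2)[OF 0(1) r] by (simp add: above_def)
  then have "height \<rho> (M \<rho> + N \<rho> - z) = 0"
    using 0(3) by (simp add: height_def order_antisym sum_nonneg)
  then have "\<forall>a\<in>base \<rho>. coord \<rho> (M \<rho> + N \<rho> - z) a = 0"
    using c by (simp add: height_def sum_nonneg_eq_0_iff)
  then have "z - M \<rho> = N \<rho>" using sum_coord[OF r, of "M \<rho> + N \<rho> - z"] by (simp add: algebra_simps)
  then show ?case using vertex_in_Lam[OF M r] vertex_in_Lam[OF N r] by (metis (full_types))
next
  case (Suc n z)
  let ?MN = "\<lambda>\<rho>. M \<rho> + N \<rho>"
  have MN: "vertex_system ?MN" using vertex_system_add[OF M N] .
  show ?case
  proof (cases "\<exists>a\<in>base \<rho>. 0 < coord \<rho> (?MN \<rho> - z) a")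
    case False
    then have "height \<rho> (M \<rho> + N \<rho> - z) \<le> 0" unfolding height_def by (force intro: sum_nonpos)
    then show ?thesis using Suc.IH[OF Suc.prems(1,2)] by simp
  next
    case True
    then obtain a where a: "a \<in> base \<rho>" "0 < coord \<rho> (?MN \<rho> - z) a" by blast
    \<comment> \<open>The vertex itself serves as the second dominant point in
      \<open>raise\<close>.\<close>
    obtain \<beta> where b: "\<beta> \<in> pos \<rho>" "z + \<beta> \<in> Lam ?MN" "dom \<rho> (z + \<beta>)"
      using raise[OF MN r Suc.prems(1,2) vertex_in_Lam[OF MN r] vertex_systemD(2)[OF MN r] a] by blast
    note br = pos_root[OF b(1)]
    have "height \<rho> (M \<rho> + N \<rho> - (z + \<beta>)) \<le> real n"
      using Suc.prems(3) height_pos_root[OF r b(1)] by (simp add: height_diff height_add r)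
    then obtain y where y: "y \<in> Lam M" "z + \<beta> - y \<in> Lam N" using Suc.IH[OF b(2,3)] by blast
    have "0 < (z + \<beta>) \<bullet> \<beta>"
      using Suc.prems(2) b(1) inner_root_self[OF br] by (simp add: dom_def inner_add_left add_nonneg_pos)
    then consider "0 < y \<bullet> \<beta>" | "0 < (z + \<beta> - y) \<bullet> \<beta>" by (fastforce simp: inner_diff_left)
    then show ?thesis
    proof cases
      case 1
      then have "y - \<beta> \<in> Lam M" using descend[OF M y(1) br] by blast
      moreover have "z - (y - \<beta>) \<in> Lam N" using y(2) by (simp add: algebra_simps)
      ultimately show ?thesis by blast
    next
      case 2
      then have "z + \<beta> - y - \<beta> \<in> Lam N" using descend[OF N y(2) br] by blast
      then have "z - y \<in> Lam N" by (simp add: algebra_simps)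
      then show ?thesis using y(1) by blast
    qed
  qed
qed

lemma Lam_sum:
  assumes M: "vertex_system M" and N: "vertex_system N" and z: "z \<in> Lam (\<lambda>\<rho>. M \<rho> + N \<rho>)"
  shows "\<exists>y\<in>Lam M. z - y \<in> Lam N"
proof -
  obtain \<rho> where r: "regular \<rho>" "dom \<rho> z" using dom_exists by blast
  obtain n where "height \<rho> (M \<rho> + N \<rho> - z) \<le> real n" using real_arch_simple by blast
  then show ?thesis by (rule Lam_sum_dominant[OF M N r(1) z r(2)])
qed

text \<open>Two opposite chambers suffice: the inequality at \<rho> bounds the integer coordinates
  of the gap from below, the one at - \<rho> from above.\<close>

lemma finite_Lam: "finite (Lam M)"
proof -
  obtain \<rho> where r: "regular \<rho>" using regular_exists by blast
  then have r': "regular (- \<rho>)" by (simp add: regular_def)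
  have flip: "above \<rho> (- v)" if "above (- \<rho>) v" for v
  proof -
    have "- v = (\<Sum>b\<in>base (- \<rho>). coord (- \<rho>) v b *\<^sub>R (- b))"
      using sum_coord[OF r', of v] by (simp add: sum_negf)
    also have "above \<rho> \<dots>"
      using that base_pos[of _ "- \<rho>"] uminus_root
      by (intro above_sum above_scale above_pos r) (auto simp: above_def pos_def)
    finally show ?thesis .
  qed
  define C where "C = coord \<rho> (M \<rho> - M (- \<rho>))"
  define f where "f y = restrict (coord \<rho> (M \<rho> - y)) (base \<rho>)" for y
  have "f ` Lam M \<subseteq> (\<Pi>\<^sub>E a\<in>base \<rho>. {k\<in>\<int>. 0 \<le> k \<and> k \<le> C a})"
  proof (clarsimp simp: f_def)
    fix y a assume y: "y \<in> Lam M" and a: "a \<in> base \<rho>"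
    have "above \<rho> (y - M (- \<rho>))" using flip[OF LamD(2)[OF y r']] by simp
    then have "coord \<rho> (M \<rho> - y) a \<le> C a" using a by (simp add: above_def C_def coord_simps r)
    then show "coord \<rho> (M \<rho> - y) a \<in> \<int> \<and> 0 \<le> coord \<rho> (M \<rho> - y) a \<and> coord \<rho> (M \<rho> - y) a \<le> C a"
      using LamD[OF y r] coord_lattice_Ints[OF r _ a] a by (simp add: above_def)
  qed
  moreover have "finite (\<Pi>\<^sub>E a\<in>base \<rho>. {k\<in>\<int>. 0 \<le> k \<and> k \<le> C a})"
    by (intro finite_PiE finite_base finite_int_segment)
  moreover have "inj_on f (Lam M)"
  proof (rule inj_onI)
    fix x y assume "f x = f y"
    then have "\<And>a. a \<in> base \<rho> \<Longrightarrow> coord \<rho> (M \<rho> - x) a = coord \<rho> (M \<rho> - y) a"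
      unfolding f_def by (metis restrict_apply')
    then have "(\<Sum>a\<in>base \<rho>. coord \<rho> (M \<rho> - x) a *\<^sub>R a) = (\<Sum>a\<in>base \<rho>. coord \<rho> (M \<rho> - y) a *\<^sub>R a)"
      by (intro sum.cong) auto
    then show "x = y" by (simp add: sum_coord r)
  qed
  ultimately show ?thesis using finite_imageD finite_subset by blast
qed

section \<open>Connectedness of the splittings under steps by roots\<close>

definition splittings :: "('a \<Rightarrow> 'a) \<Rightarrow> ('a \<Rightarrow> 'a) \<Rightarrow> 'a \<Rightarrow> 'a set" where
  "splittings M N z = {y\<in>Lam M. z - y \<in> Lam N}"

text \<open>A root \<beta> raising \<open>y\<close> in \<open>Lam M\<close> also works for the other
  summand if (z - y, \<beta>) > 0. Otherwise (y' - y, \<beta>) > 0 makes (z - y', \<beta>) negative,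
  and dominance of \<open>y\<close> makes (y', \<beta>) positive; then \<beta> can be taken from
  \<open>y'\<close> and given to \<open>z - y'\<close>.\<close>

lemma splittings_step:
  assumes M: "vertex_system M" and N: "vertex_system N" and r: "regular \<rho>"
    and y: "y \<in> splittings M N z" "dom \<rho> y" and y': "y' \<in> splittings M N z" "dom \<rho> y'"
    and a: "a \<in> base \<rho>" "0 < coord \<rho> (y' - y) a"
  obtains \<beta> where "\<beta> \<in> \<Delta>" "\<beta> \<bullet> \<beta> \<le> (y' - y) \<bullet> \<beta>"
    "y + \<beta> \<in> splittings M N z \<or> y' - \<beta> \<in> splittings M N z"
proof -
  have yM: "y \<in> Lam M" "y' \<in> Lam M" and yN: "z - y \<in> Lam N" "z - y' \<in> Lam N"
    using y y' by (auto simp: splittings_def)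
  obtain \<beta> where b: "\<beta> \<in> pos \<rho>" "\<beta> \<bullet> \<beta> \<le> (y' - y) \<bullet> \<beta>" "y + \<beta> \<in> Lam M"
    using raise[OF M r yM(1) y(2) yM(2) y'(2) a] by blast
  note br = pos_root[OF b(1)]
  have bb: "0 < \<beta> \<bullet> \<beta>" using inner_root_self[OF br] .
  show ?thesis
  proof (cases "0 < (z - y) \<bullet> \<beta>")
    case True
    then have "z - y - \<beta> \<in> Lam N" using descend[OF N yN(1) br] by blast
    then have "y + \<beta> \<in> splittings M N z" using b(3) by (simp add: splittings_def algebra_simps)
    then show ?thesis using that br b(2) by blast
  next
    case False
    then have "(z - y') \<bullet> \<beta> < 0" using b(2) bb by (simp add: inner_diff_left del: inner_gt_zero_iff)
    then have "z - y' + \<beta> \<in> Lam N" using ascend[OF N yN(2) br] by blast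
    moreover have "0 \<le> y \<bullet> \<beta>" using b(1) y(2) by (simp add: dom_def)
    then have "0 < y' \<bullet> \<beta>" using b(2) bb by (simp add: inner_diff_left del: inner_gt_zero_iff)
    then have "y' - \<beta> \<in> Lam M" using descend[OF M yM(2) br] by blast
    ultimately have "y' - \<beta> \<in> splittings M N z" by (simp add: splittings_def algebra_simps)
    then show ?thesis using that br b(2) by blast
  qed
qed

lemma norm_step:
  fixes x b :: "'a"
  assumes "b \<bullet> b \<le> x \<bullet> b" "0 < b \<bullet> b"
  shows "(norm (x - b))\<^sup>2 < (norm x)\<^sup>2"
  using assms
  by (simp add: power2_norm_eq_inner inner_diff_left inner_diff_right inner_commute del: inner_gt_zero_iff)

text \<open>The change of the squared distance is 2 (y, \<beta>) + (\<beta>, \<beta>) - 2 (\<beta>,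
  \<rho>). Pairing at most -1 makes the first two terms together nonpositive, and the last one makes
  the change strictly negative.\<close>

lemma norm_step_towards:
  assumes r: "\<beta> \<in> pos \<rho>" and y: "y \<bullet> coroot \<beta> \<le> - 1"
  shows "(norm (y + \<beta> - \<rho>))\<^sup>2 < (norm (y - \<rho>))\<^sup>2"
proof -
  have bb: "0 < \<beta> \<bullet> \<beta>" using inner_root_self[OF pos_root[OF r]] .
  have "y \<bullet> \<beta> * 2 \<le> - (\<beta> \<bullet> \<beta>)" using y bb by (simp add: pairing_eq field_simps)
  moreover have "0 < \<beta> \<bullet> \<rho>" using r by (simp add: pos_def)
  ultimately show ?thesis
    by (simp add: power2_norm_eq_inner inner_diff_left inner_diff_right inner_add_left inner_add_right
        inner_commute)
qed

text \<open>Since \<open>z\<close> is nonnegative on \<beta> and \<open>y\<close> negative, the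
  complement \<open>z - y\<close> is positive on \<beta>: the same root can be added to one summand
  and subtracted from the other.\<close>

lemma splittings_raise:
  assumes M: "vertex_system M" and N: "vertex_system N" and z: "dom \<rho> z"
    and y: "y \<in> splittings M N z" and b: "\<beta> \<in> pos \<rho>" and n: "y \<bullet> \<beta> < 0"
  shows "y + \<beta> \<in> splittings M N z" "y \<bullet> coroot \<beta> \<le> - 1"
proof -
  note br = pos_root[OF b]
  have yM: "y \<in> Lam M" and yN: "z - y \<in> Lam N" using y by (auto simp: splittings_def)
  have "0 < (z - y) \<bullet> \<beta>" using z b n by (force simp: dom_def inner_diff_left)
  then have "z - y - \<beta> \<in> Lam N" using descend[OF N yN br] by blast
  then show "y + \<beta> \<in> splittings M N z"
    using ascend[OF M yM br n] by (simp add: splittings_def algebra_simps)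
  have "y \<bullet> coroot \<beta> < 0" using pairing_neg_iff[OF br] n by blast
  then show "y \<bullet> coroot \<beta> \<le> - 1"
    using Ints_less_add_1[of "y \<bullet> coroot \<beta>" 0] pairing_Lam[OF M yM br] by simp
qed

text \<open>
  Choose \<open>y\<close> in \<open>K\<close> and \<open>y'\<close> outside at minimal distance and, among those pairs, as close as possible to
  a regular \<open>\<rho>\<close> whose chamber makes \<open>z\<close> dominant. Moving \<open>y\<close>, \<open>y'\<close> or both by a positive root shows
  that both are dominant; then \<open>splittings_step\<close> brings them closer.
\<close>

lemma splittings_connected:
  assumes M: "vertex_system M" and N: "vertex_system N"
    and y0: "y0 \<in> K" and y1: "y1 \<in> splittings M N z" and K: "K \<subseteq> splittings M N z"
    and closed: "\<And>y \<beta>. y \<in> K \<Longrightarrow> \<beta> \<in> \<Delta> \<Longrightarrow> y + \<beta> \<in> splittings M N z \<Longrightarrow> y + \<beta> \<in> K"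
  shows "y1 \<in> K"
proof (rule ccontr)
  assume y1K: "y1 \<notin> K"
  let ?A = "splittings M N z"
  define K' where "K' = ?A - K"
  have closed': "y + \<beta> \<in> K'" if "y \<in> K'" "\<beta> \<in> \<Delta>" "y + \<beta> \<in> ?A" for y \<beta>
    using that closed[of "y + \<beta>" "- \<beta>"] uminus_root by (auto simp: K'_def)
  obtain \<rho> where r: "regular \<rho>" "dom \<rho> z" using dom_exists by blast
  \<comment> \<open>Both measures carry a minus sign because the extremal pair is obtained as a
    maximum.\<close>
  define e where "e p = - (norm (snd p - fst p))\<^sup>2" for p :: "'a \<times> 'a"
  define h where "h p = - ((norm (fst p - \<rho>))\<^sup>2 + (norm (snd p - \<rho>))\<^sup>2)" for p
  have "finite ?A" using finite_Lam by (auto simp: splittings_def)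
  then have fin: "finite (K \<times> K')" using K finite_subset by (auto simp: K'_def)
  moreover have "K \<times> K' \<noteq> {}" using y0 y1 y1K by (auto simp: K'_def)
  ultimately obtain p0 where p0: "p0 \<in> K \<times> K'" "\<And>q. q \<in> K \<times> K' \<Longrightarrow> e q \<le> e p0"
    using obtain_max_real[of "K \<times> K'" e] by blast
  have "finite {q\<in>K \<times> K'. e q = e p0}" "{q\<in>K \<times> K'. e q = e p0} \<noteq> {}" using fin p0 by auto
  then obtain p where p: "p \<in> {q\<in>K \<times> K'. e q = e p0}"
    and hp: "\<And>q. q \<in> {q\<in>K \<times> K'. e q = e p0} \<Longrightarrow> h q \<le> h p"
    using obtain_max_real[of "{q\<in>K \<times> K'. e q = e p0}" h] by blast
  obtain y y' where yy: "p = (y, y')" by (cases p)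
  have yK: "y \<in> K" and yK': "y' \<in> K'" and ep: "e (y, y') = e p0" using p yy by auto
  have emin: "(norm (y' - y))\<^sup>2 \<le> (norm (w' - w))\<^sup>2" if "w \<in> K" "w' \<in> K'" for w w'
    using p0(2)[of "(w, w')"] that ep by (simp add: e_def)
  have hmin: "(norm (y - \<rho>))\<^sup>2 + (norm (y' - \<rho>))\<^sup>2 \<le> (norm (w - \<rho>))\<^sup>2 + (norm (w' - \<rho>))\<^sup>2"
    if "w \<in> K" "w' \<in> K'" "(norm (w' - w))\<^sup>2 = (norm (y' - y))\<^sup>2" for w w'
    using hp[of "(w, w')"] that ep by (simp add: e_def h_def yy)
  have yA: "y \<in> ?A" "y' \<in> ?A" using yK yK' K by (auto simp: K'_def)
  have pZ: "x \<bullet> coroot \<beta> \<in> \<int>" if "x \<in> ?A" "\<beta> \<in> \<Delta>" for x \<beta>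
    using that pairing_Lam[OF M] by (auto simp: splittings_def)
  \<comment> \<open>The roles of \<open>y\<close> and \<open>y'\<close> are symmetric here, so
    \<open>w\<close> stands for either of them.\<close>
  have dom_aux: "0 \<le> w \<bullet> \<beta>"
    if b: "\<beta> \<in> pos \<rho>" and w: "{w, w'} = {y, y'}" for w w' \<beta>
  proof (rule ccontr)
    assume "\<not> ?thesis"
    then have neg: "w \<bullet> \<beta> < 0" by simp
    note br = pos_root[OF b]
    have bb: "0 < \<beta> \<bullet> \<beta>" using inner_root_self[OF br] .
    have wA: "w \<in> ?A" "w' \<in> ?A" using w yA by auto
    note up = splittings_raise[OF M N r(2) wA(1) b neg]
    \<comment> \<open>The integer \<open>d\<close> decides the move. For d \<ge> 2, raising
      \<open>w\<close> alone shortens the distance. For d = 1 it keeps the distance and brings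
      \<open>w\<close> closer to \<rho>. For d \<le> 0 also \<open>w'\<close> is negative on
      \<beta>, and raising both keeps their difference and brings both closer to \<rho>.\<close>
    define d where "d = (w' - w) \<bullet> coroot \<beta>"
    have db: "(w' - w) \<bullet> \<beta> = d * (\<beta> \<bullet> \<beta>) / 2" using bb by (simp add: d_def pairing_eq)
    have sw: "norm (w' - w) = norm (y' - y)" "norm (w - \<rho>)^2 + norm (w' - \<rho>)^2 = norm (y - \<rho>)^2 + norm (y' - \<rho>)^2"
      using w by (auto simp: doubleton_eq_iff norm_minus_commute)
    have min1: "(norm (y' - y))\<^sup>2 \<le> (norm (w' - (w + \<beta>)))\<^sup>2"
      using w up(1) emin[of "y + \<beta>" y'] emin[of y "y' + \<beta>"] closed[OF yK br] closed'[OF yK' br] yK yK'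
      by (auto simp: doubleton_eq_iff norm_minus_commute)
    have min2: "(norm (y - \<rho>))\<^sup>2 + (norm (y' - \<rho>))\<^sup>2 \<le> (norm (w + \<beta> - \<rho>))\<^sup>2 + (norm (w' - \<rho>))\<^sup>2"
      if "(norm (w' - (w + \<beta>)))\<^sup>2 = (norm (y' - y))\<^sup>2"
      using that w up(1) hmin[of "y + \<beta>" y'] hmin[of y "y' + \<beta>"] closed[OF yK br] closed'[OF yK' br] yK yK'
      by (auto simp: doubleton_eq_iff norm_minus_commute add.commute)
    have nsq: "(norm (w' - (w + \<beta>)))\<^sup>2 = (norm (w' - w))\<^sup>2 + (1 - d) * (\<beta> \<bullet> \<beta>)"
      using db by (simp add: power2_norm_eq_inner inner_diff_left inner_diff_right inner_add_left
          inner_add_right inner_commute algebra_simps)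
    have closer: "(norm (w + \<beta> - \<rho>))\<^sup>2 < (norm (w - \<rho>))\<^sup>2"
      using norm_step_towards[OF b up(2)] .
    have dZ: "d \<in> \<int>" using pZ[OF wA(2) br] pZ[OF wA(1) br] by (simp add: d_def inner_diff_left)
    have "d \<le> 1"
    proof (rule ccontr)
      assume "\<not> ?thesis"
      then have "(1 - d) * (\<beta> \<bullet> \<beta>) < 0" using bb by (simp add: mult_less_0_iff)
      then show False using min1 nsq sw(1) by simp
    qed
    then consider "d = 1" | "d \<le> 0" using Ints_less_add_1[OF dZ, of 1] by fastforce
    then show False
    proof cases
      case 1
      then show False using min2 nsq sw closer by simp
    next
      case 2
      have "w' \<bullet> \<beta> < 0"
      proof -
        have "(w' - w) \<bullet> \<beta> \<le> 0" using 2 bb by (simp add: db mult_nonpos_nonneg)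
        then show ?thesis using neg by (simp add: inner_diff_left)
      qed
      note up' = splittings_raise[OF M N r(2) wA(2) b this]
      have "(norm (w' + \<beta> - \<rho>))\<^sup>2 < (norm (w' - \<rho>))\<^sup>2"
        using norm_step_towards[OF b up'(2)] .
      moreover have "(norm (y - \<rho>))\<^sup>2 + (norm (y' - \<rho>))\<^sup>2 \<le> (norm (w + \<beta> - \<rho>))\<^sup>2 + (norm (w' + \<beta> - \<rho>))\<^sup>2"
        using w up(1) up'(1) hmin[of "y + \<beta>" "y' + \<beta>"] closed[OF yK br] closed'[OF yK' br]
        by (auto simp: doubleton_eq_iff add.commute)
      ultimately show False using closer sw(2) by simp
    qed
  qed
  have d: "dom \<rho> y" "dom \<rho> y'" using dom_aux[of _ y y'] dom_aux[of _ y' y] by (auto simp: dom_def)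
  have "\<exists>a\<in>base \<rho>. coord \<rho> (y' - y) a \<noteq> 0"
  proof (rule ccontr)
    assume "\<not> ?thesis"
    then have "y' = y" using sum_coord[OF r(1), of "y' - y"] by simp
    then show False using yK yK' by (simp add: K'_def)
  qed
  then obtain a where a: "a \<in> base \<rho>" "0 < coord \<rho> (y' - y) a \<or> 0 < coord \<rho> (y - y') a"
    by (force simp: coord_simps r(1))
  then show False
  proof (elim disjE)
    assume "0 < coord \<rho> (y' - y) a"
    then obtain \<beta> where b: "\<beta> \<in> \<Delta>" "\<beta> \<bullet> \<beta> \<le> (y' - y) \<bullet> \<beta>" "y + \<beta> \<in> ?A \<or> y' - \<beta> \<in> ?A"
      using splittings_step[OF M N r(1) yA(1) d(1) yA(2) d(2) a(1)] by blast
    then have "y + \<beta> \<in> K \<or> y' - \<beta> \<in> K'"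
      using closed[OF yK] closed'[OF yK', of "- \<beta>"] uminus_root by auto
    moreover have "y' - (y + \<beta>) = y' - y - \<beta>" "y' - \<beta> - y = y' - y - \<beta>" by simp_all
    ultimately have "(norm (y' - y))\<^sup>2 \<le> (norm (y' - y - \<beta>))\<^sup>2"
      using emin[of "y + \<beta>" y'] emin[of y "y' - \<beta>"] yK yK' by metis
    then show False using norm_step[OF b(2) inner_root_self[OF b(1)]] by linarith
  next
    assume "0 < coord \<rho> (y - y') a"
    then obtain \<beta> where b: "\<beta> \<in> \<Delta>" "\<beta> \<bullet> \<beta> \<le> (y - y') \<bullet> \<beta>" "y' + \<beta> \<in> ?A \<or> y - \<beta> \<in> ?A"
      using splittings_step[OF M N r(1) yA(2) d(2) yA(1) d(1) a(1)] by blast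
    then have "y' + \<beta> \<in> K' \<or> y - \<beta> \<in> K"
      using closed'[OF yK'] closed[OF yK, of "- \<beta>"] uminus_root by auto
    moreover have "norm (y' - (y - \<beta>)) = norm (y - y' - \<beta>)" "norm (y' + \<beta> - y) = norm (y - y' - \<beta>)"
      using norm_minus_commute[of "\<beta> + y'" y] by (simp_all add: algebra_simps)
    ultimately have "(norm (y' - y))\<^sup>2 \<le> (norm (y - y' - \<beta>))\<^sup>2"
      using emin[of "y - \<beta>" y'] emin[of y "y' + \<beta>"] yK yK' by metis
    then show False
      using norm_step[OF b(2) inner_root_self[OF b(1)]] unfolding norm_minus_commute[of y y'] by linarith
  qed
qed

end

subsection \<open>Presentations\<close>

lemma generated_semigroup_eq:
  fixes G :: "'b::comm_monoid_add set"
  shows "generated_semigroup G = sum_mset ` free_comm_semigroup G"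
proof
  show "generated_semigroup G \<subseteq> sum_mset ` free_comm_semigroup G"
  proof
    fix s assume "s \<in> generated_semigroup G"
    then show "s \<in> sum_mset ` free_comm_semigroup G"
    proof induction
      case (gen g)
      then show ?case by (intro image_eqI[of _ _ "{#g#}"]) (auto simp: free_comm_semigroup_def)
    next
      case (add s t)
      then obtain U V where "s = sum_mset U" "t = sum_mset V"
        "U \<in> free_comm_semigroup G" "V \<in> free_comm_semigroup G" by blast
      then show ?case by (intro image_eqI[of _ _ "U + V"]) (auto simp: free_comm_semigroup_def)
    qed
  qed
  have "U \<noteq> {#} \<Longrightarrow> set_mset U \<subseteq> G \<Longrightarrow> sum_mset U \<in> generated_semigroup G" for U
  proof (induction U)
    case (add x U)
    then show ?case
      by (cases "U = {#}") (auto intro: generated_semigroup.intros)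
  qed simp
  then show "sum_mset ` free_comm_semigroup G \<subseteq> generated_semigroup G"
    by (auto simp: free_comm_semigroup_def)
qed

lemma generated_congruence_free:
  "(U, V) \<in> generated_congruence G R \<Longrightarrow> U \<in> free_comm_semigroup G \<and> V \<in> free_comm_semigroup G"
  by (induction rule: generated_congruence.induct) (auto simp: free_comm_semigroup_def)

lemma generated_congruence_sum:
  assumes "\<And>U V. (U, V) \<in> R \<Longrightarrow> sum_mset U = sum_mset V"
  shows "(U, V) \<in> generated_congruence G R \<Longrightarrow> sum_mset U = sum_mset V"
  by (induction rule: generated_congruence.induct) (auto simp: assms)

text \<open>Together the two hypotheses identify the congruence with the kernel of summation, so
  summing any representative of a class is the isomorphism.\<close>

lemma presented_by_if:
  fixes G :: "'b::comm_monoid_add set"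
  assumes sound: "\<And>U V. (U, V) \<in> R \<Longrightarrow> sum_mset U = sum_mset V"
    and complete: "\<And>U V. U \<in> free_comm_semigroup G \<Longrightarrow> V \<in> free_comm_semigroup G \<Longrightarrow>
      sum_mset U = sum_mset V \<Longrightarrow> (U, V) \<in> generated_congruence G R"
  shows "presented_by (generated_semigroup G) G R"
proof -
  define F where "F = free_comm_semigroup G"
  define E where "E = generated_congruence G R"
  define \<phi> where "\<phi> A = sum_mset (SOME U. U \<in> A)" for A :: "'b multiset set"
  have E: "(U, V) \<in> E \<longleftrightarrow> U \<in> F \<and> V \<in> F \<and> sum_mset U = sum_mset V" for U V
    using generated_congruence_sum[OF sound, where R = R] generated_congruence_free complete
    unfolding E_def F_def by blast
  have \<phi>: "\<phi> (E `` {U}) = sum_mset U" if "U \<in> F" for U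
  proof -
    have "U \<in> E `` {U}" using that by (simp add: E)
    then have "(SOME V. V \<in> E `` {U}) \<in> E `` {U}" by (rule someI)
    then have "(U, SOME V. V \<in> E `` {U}) \<in> E" by (rule Image_singleton_iff[THEN iffD1])
    then show ?thesis unfolding \<phi>_def E by simp
  qed
  have Q: "F // E = (\<lambda>U. E `` {U}) ` F" by (auto simp: quotient_def)
  have class_eq: "E `` {U} = {V\<in>F. sum_mset V = sum_mset U}" if "U \<in> F" for U
    using that E by auto
  have "bij_betw \<phi> (F // E) (generated_semigroup G)"
    unfolding bij_betw_def
  proof
    show "inj_on \<phi> (F // E)"
    proof (rule inj_onI)
      fix A B assume "A \<in> F // E" "B \<in> F // E" and eq: "\<phi> A = \<phi> B"
      then obtain U V where "U \<in> F" "V \<in> F" "A = E `` {U}" "B = E `` {V}" unfolding Q by blast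
      then show "A = B" using eq \<phi>[of U] \<phi>[of V] class_eq[of U] class_eq[of V] by simp
    qed
    show "\<phi> ` (F // E) = generated_semigroup G"
      unfolding Q generated_semigroup_eq F_def[symmetric] image_image by (rule image_cong) (auto simp: \<phi>)
  qed
  moreover have "\<phi> (class_add E A B) = \<phi> A + \<phi> B" if AB: "A \<in> F // E" "B \<in> F // E" for A B
  proof -
    obtain U V where UV: "U \<in> F" "V \<in> F" "A = E `` {U}" "B = E `` {V}" using AB unfolding Q by blast
    have F_add: "U' + V' \<in> F" if "U' \<in> F" "V' \<in> F" for U' V'
      using that by (auto simp: F_def free_comm_semigroup_def)
    have "class_add E A B = E `` {U + V}"
      using UV F_add by (auto simp: class_add_def class_eq)
    then show ?thesis using UV F_add by (simp add: \<phi>)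
  qed
  moreover have "\<phi> (E `` {{#g#}}) = g" if "g \<in> G" for g
    using \<phi>[of "{#g#}"] that by (simp add: F_def free_comm_semigroup_def)
  ultimately show ?thesis
    unfolding presented_by_def Let_def F_def[symmetric] E_def[symmetric] by blast
qed

section \<open>Quadratic moves and decompositions into degree one elements\<close>

lemma quadratic_move:
  fixes L :: "'a::euclidean_space set"
  assumes "x \<in> L" "y \<in> L" "x' \<in> L" "y' \<in> L" "x + y = x' + y'" and W: "set_mset W \<subseteq> L \<times> {1}"
  shows "({#(x, 1), (y, 1)#} + W, {#(x', 1), (y', 1)#} + W)
    \<in> generated_congruence (L \<times> {1}) (quadratic_relations L)"
proof -
  have "({#(x, 1), (y, 1)#}, {#(x', 1), (y', 1)#}) \<in> quadratic_relations L"
    using assms unfolding quadratic_relations_def by blast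
  then have *: "({#(x, 1), (y, 1)#}, {#(x', 1), (y', 1)#})
      \<in> generated_congruence (L \<times> {1}) (quadratic_relations L)"
    by (rule generated_congruence.rel) (use assms in \<open>auto simp: free_comm_semigroup_def\<close>)
  \<comment> \<open>The free semigroup has no empty multiset, so the congruence rule for addition
    does not apply to an empty rest.\<close>
  show ?thesis
  proof (cases "W = {#}")
    case False
    then show ?thesis using generated_congruence.add[OF *] W by (auto simp: free_comm_semigroup_def)
  qed (use * in simp)
qed

lemma generated_congruence_add_mset:
  assumes "(U, V) \<in> generated_congruence G R" "g \<in> G"
  shows "(add_mset g U, add_mset g V) \<in> generated_congruence G R"
  using generated_congruence.add[OF assms(1), of "{#g#}"] assms(2) by (simp add: free_comm_semigroup_def)

lemma sum_mset_inner:
  fixes W :: "('a::euclidean_space \<times> int) multiset"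
  shows "fst (sum_mset W) \<bullet> v = (\<Sum>w\<in>#W. fst w \<bullet> v)"
  by (induction W) (auto simp: inner_add_left)

lemma sum_mset_pos_ex:
  fixes f :: "'b \<Rightarrow> real"
  assumes "0 < (\<Sum>w\<in>#W. f w)"
  shows "\<exists>w\<in>#W. 0 < f w"
proof (rule ccontr)
  assume "\<not> ?thesis"
  then have "(\<Sum>w\<in>#W. f w) \<le> (\<Sum>w\<in>#W. 0)" by (intro sum_mset_mono) force
  then show False using assms by simp
qed

context reduced_root_system
begin

lemma sum_in_Lam:
  assumes "set_mset W \<subseteq> Lam M \<times> {1}"
  shows "fst (sum_mset W) \<in> Lam (\<lambda>\<rho>. real (size W) *\<^sub>R M \<rho>) \<and> snd (sum_mset W) = int (size W)"
  using assms
proof (induction W)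
  \<comment> \<open>The empty sum 0 lies in the dilation by 0, all of whose vertices are 0.\<close>
  case empty
  then show ?case by (simp add: Lam_def above_zero root_lattice_closed)
next
  case (add w W)
  then have "fst w + fst (sum_mset W) \<in> Lam (\<lambda>\<rho>. M \<rho> + real (size W) *\<^sub>R M \<rho>)"
    by (intro Lam_add) auto
  then show ?case using add by (auto simp: scaleR_left_distrib)
qed

text \<open>One summand is split off at a time by \<open>Lam_sum\<close>. Besides saturation, this
  supplies the auxiliary decompositions in \<open>quadratic_connected\<close>.\<close>

lemma Lam_decompose:
  assumes M: "vertex_system M" and m: "1 \<le> m"
  shows "z \<in> Lam (\<lambda>\<rho>. real m *\<^sub>R M \<rho>) \<Longrightarrow>
    \<exists>W. set_mset W \<subseteq> Lam M \<times> {1} \<and> size W = m \<and> sum_mset W = (z, int m)"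
  using m
proof (induction m arbitrary: z rule: dec_induct)
  case base
  then show ?case by (intro exI[of _ "{#(z, 1)#}"]) simp
next
  case (step m z)
  have "z \<in> Lam (\<lambda>\<rho>. M \<rho> + real m *\<^sub>R M \<rho>)" using step.prems by (simp add: scaleR_left_distrib)
  then obtain y where y: "y \<in> Lam M" "z - y \<in> Lam (\<lambda>\<rho>. real m *\<^sub>R M \<rho>)"
    using Lam_sum[OF M vertex_system_scale[OF M]] by blast
  then obtain W where "set_mset W \<subseteq> Lam M \<times> {1}" "size W = m" "sum_mset W = (z - y, int m)"
    using step.IH by blast
  then show ?case using y by (intro exI[of _ "add_mset (y, 1) W"]) auto
qed

text \<open>
  For decompositions with first entries \<open>y\<close> and $y + \beta$, the remaining entries sum to $z - y$ and
  $z - y - \beta$. Either the first sum pairs positively with \<open>\<beta>\<close> or the second one negatively, so \<open>\<beta>\<close> can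
  be moved between the first entry and one of the others.
\<close>

lemma quadratic_connected:
  assumes M: "vertex_system M" and n: "1 \<le> n"
  defines "G \<equiv> Lam M \<times> {1}"
  defines "E \<equiv> generated_congruence G (quadratic_relations (Lam M))"
  shows "set_mset U \<subseteq> G \<Longrightarrow> set_mset V \<subseteq> G \<Longrightarrow> size U = n \<Longrightarrow> size V = n \<Longrightarrow>
    fst (sum_mset U) = fst (sum_mset V) \<Longrightarrow> (U, V) \<in> E"
  using n
proof (induction n arbitrary: U V rule: dec_induct)
  case base
  then obtain u v where "U = {#u#}" "V = {#v#}" by (metis One_nat_def size_1_singleton_mset)
  then have "U = V" using base by (auto simp: G_def)
  moreover have "U \<in> free_comm_semigroup G" using base by (auto simp: free_comm_semigroup_def)
  ultimately show ?case unfolding E_def by (simp add: generated_congruence.refl)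
next
  case (step m U V)
  define N where "N = (\<lambda>\<rho>. real m *\<^sub>R M \<rho>)"
  have N: "vertex_system N" unfolding N_def by (rule vertex_system_scale[OF M])
  obtain u U' where U: "U = add_mset u U'" "size U' = m"
    using size_eq_Suc_imp_eq_union[OF step.prems(3)] step.prems(3) by auto
  obtain v V' where V: "V = add_mset v V'" "size V' = m"
    using size_eq_Suc_imp_eq_union[OF step.prems(4)] step.prems(4) by auto
  obtain y0 where u: "u = (y0, 1)" "y0 \<in> Lam M" using U step.prems(1) by (auto simp: G_def)
  obtain y1 where v: "v = (y1, 1)" "y1 \<in> Lam M" using V step.prems(2) by (auto simp: G_def)
  have U'G: "set_mset U' \<subseteq> G" and V'G: "set_mset V' \<subseteq> G" using U V step.prems by auto
  define z where "z = fst (sum_mset U)"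
  have zU: "z - y0 = fst (sum_mset U')" by (simp add: z_def U u)
  have zV: "z - y1 = fst (sum_mset V')" unfolding z_def step.prems(5) by (simp add: V v)
  let ?A = "splittings M N z"
  \<comment> \<open>By the induction hypothesis all choices of the remaining entries are congruent,
    so demanding the congruence for every \<open>W\<close> is no stronger than for one; that some
    \<open>W\<close> exists is guaranteed by \<open>Lam_decompose\<close>.\<close>
  define K where "K = {y\<in>?A. \<forall>W. set_mset W \<subseteq> G \<longrightarrow> size W = m \<longrightarrow> fst (sum_mset W) = z - y \<longrightarrow>
    (U, add_mset (y, 1) W) \<in> E}"
  have LG: "y \<in> Lam M \<Longrightarrow> (y, 1) \<in> G" for y by (simp add: G_def)
  have tr: "(X, Y) \<in> E \<Longrightarrow> (Y, Z) \<in> E \<Longrightarrow> (X, Z) \<in> E" for X Y Z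
    unfolding E_def by (rule generated_congruence.trans)
  have addE: "(X, Y) \<in> E \<Longrightarrow> g \<in> G \<Longrightarrow> (add_mset g X, add_mset g Y) \<in> E" for X Y g
    unfolding E_def by (rule generated_congruence_add_mset)
  have y0K: "y0 \<in> K"
  proof -
    have "y0 \<in> ?A"
      using sum_in_Lam[of U' M] U'G U u(2) by (simp add: splittings_def zU N_def G_def)
    moreover have "(U, add_mset (y0, 1) W) \<in> E"
      if "set_mset W \<subseteq> G" "size W = m" "fst (sum_mset W) = z - y0" for W
      unfolding U u(1) using step.IH[of U' W] U'G U(2) that zU u LG by (intro addE) auto
    ultimately show ?thesis by (simp add: K_def)
  qed
  moreover have "y1 \<in> ?A"
    using sum_in_Lam[of V' M] V'G V v(2) by (simp add: splittings_def zV N_def G_def)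
  moreover have "K \<subseteq> ?A" by (auto simp: K_def)
  moreover have "y + \<beta> \<in> K" if y: "y \<in> K" and b: "\<beta> \<in> \<Delta>" and yb: "y + \<beta> \<in> ?A" for y \<beta>
  proof -
    have bb: "0 < \<beta> \<bullet> \<beta>" using inner_root_self[OF b] .
    have yA: "y \<in> Lam M" "z - y \<in> Lam N" and ybM: "y + \<beta> \<in> Lam M"
      using y yb by (auto simp: K_def splittings_def)
    have yE: "(U, add_mset (y, 1) W) \<in> E"
      if "set_mset W \<subseteq> G" "size W = m" "fst (sum_mset W) = z - y" for W
      using y that by (simp add: K_def)
    have "(U, add_mset (y + \<beta>, 1) W') \<in> E"
      if W': "set_mset W' \<subseteq> G" "size W' = m" "fst (sum_mset W') = z - (y + \<beta>)" for W'
    proof (cases "0 < (z - y) \<bullet> \<beta>")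
      case True
      obtain W where W: "set_mset W \<subseteq> G" "size W = m" "fst (sum_mset W) = z - y"
        using Lam_decompose[OF M step.hyps(1) yA(2)[unfolded N_def]] unfolding G_def by auto
      then obtain w where w: "w \<in># W" "0 < fst w \<bullet> \<beta>"
        using True sum_mset_inner[of W \<beta>] sum_mset_pos_ex[of "\<lambda>w. fst w \<bullet> \<beta>" W] by auto
      then obtain W'' where W'': "W = add_mset w W''" by (metis mset_add)
      obtain x where x: "w = (x, 1)" "x \<in> Lam M" using w W by (auto simp: G_def)
      have xb: "x - \<beta> \<in> Lam M" using descend[OF M x(2) b] w x by simp
      have "({#(y, 1), (x, 1)#} + W'', {#(y + \<beta>, 1), (x - \<beta>, 1)#} + W'') \<in> E"
        unfolding E_def G_def using yA ybM x xb W(1) W'' by (intro quadratic_move) (auto simp: G_def)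
      then have "(add_mset (y, 1) W, add_mset (y + \<beta>, 1) (add_mset (x - \<beta>, 1) W'')) \<in> E"
        by (simp add: W'' x)
      \<comment> \<open>Both remainders have \<open>m\<close> entries and sum z - y - \<beta>, so
        the induction hypothesis links them.\<close>
      moreover have "(add_mset (x - \<beta>, 1) W'', W') \<in> E"
        using step.IH[of "add_mset (x - \<beta>, 1) W''" W'] W' W W'' x xb LG by (auto simp: algebra_simps)
      ultimately show ?thesis using yE[OF W] tr addE LG ybM by blast
    next
      case False
      \<comment> \<open>Subtracting \<beta> once more turns the nonpositive product of
        \<open>z - y\<close> into a negative one, so some entry of the given \<open>W'\<close> can
        absorb \<beta>.\<close>
      then have "0 < fst (sum_mset W') \<bullet> (- \<beta>)"
        using bb by (simp add: W' inner_diff_left inner_add_left del: inner_gt_zero_iff)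
      then obtain w where w: "w \<in># W'" "fst w \<bullet> \<beta> < 0"
        using sum_mset_inner[of W' "- \<beta>"] sum_mset_pos_ex[of "\<lambda>w. fst w \<bullet> (- \<beta>)" W'] by auto
      then obtain W'' where W'': "W' = add_mset w W''" by (metis mset_add)
      obtain x where x: "w = (x, 1)" "x \<in> Lam M" using w W' by (auto simp: G_def)
      have xb: "x + \<beta> \<in> Lam M" using ascend[OF M x(2) b] w x by simp
      have "({#(y, 1), (x + \<beta>, 1)#} + W'', {#(y + \<beta>, 1), (x, 1)#} + W'') \<in> E"
        unfolding E_def G_def using yA ybM x xb W'(1) W'' by (intro quadratic_move) (auto simp: G_def)
      then have "(add_mset (y, 1) (add_mset (x + \<beta>, 1) W''), add_mset (y + \<beta>, 1) W') \<in> E"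
        by (simp add: W'' x)
      moreover have "(U, add_mset (y, 1) (add_mset (x + \<beta>, 1) W'')) \<in> E"
        using W' W'' x xb LG by (intro yE) (auto simp: algebra_simps)
      ultimately show ?thesis using tr by blast
    qed
    then show ?thesis using yb by (simp add: K_def)
  qed
  ultimately have "y1 \<in> K" by (rule splittings_connected[OF M N])
  then show ?case using V'G V v zV by (simp add: K_def)
qed

lemma presented_by_Lam:
  assumes M: "vertex_system M"
  shows "presented_by (generated_semigroup (Lam M \<times> {1})) (Lam M \<times> {1}) (quadratic_relations (Lam M))"
proof (rule presented_by_if)
  fix U V assume "(U, V) \<in> quadratic_relations (Lam M)"
  then show "sum_mset U = sum_mset V" by (auto simp: quadratic_relations_def)
next
  fix U V assume UV: "U \<in> free_comm_semigroup (Lam M \<times> {1::int})" "V \<in> free_comm_semigroup (Lam M \<times> {1})"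
    "sum_mset U = sum_mset V"
  then have "set_mset U \<subseteq> Lam M \<times> {1}" "set_mset V \<subseteq> Lam M \<times> {1}" "1 \<le> size U"
    by (auto simp: free_comm_semigroup_def Suc_le_eq nonempty_has_size)
  \<comment> \<open>The second component of the sum counts the summands.\<close>
  moreover from this have "size V = size U"
    using sum_in_Lam[of U M] sum_in_Lam[of V M] UV(3) by simp
  ultimately show "(U, V) \<in> generated_congruence (Lam M \<times> {1}) (quadratic_relations (Lam M))"
    using quadratic_connected[OF M _ _ _ HOL.refl] UV(3) by simp
qed

lemma generated_semigroup_Lam:
  assumes M: "vertex_system M"
  shows "generated_semigroup (Lam M \<times> {1}) = (\<Union>m\<in>{1::nat..}. Lam (\<lambda>\<rho>. real m *\<^sub>R M \<rho>) \<times> {int m})"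
  unfolding generated_semigroup_eq
proof
  show "sum_mset ` free_comm_semigroup (Lam M \<times> {1}) \<subseteq> (\<Union>m\<in>{1::nat..}. Lam (\<lambda>\<rho>. real m *\<^sub>R M \<rho>) \<times> {int m})"
  proof (rule image_subsetI)
    fix W assume "W \<in> free_comm_semigroup (Lam M \<times> {1::int})"
    then have W: "set_mset W \<subseteq> Lam M \<times> {1}" "1 \<le> size W"
      by (auto simp: free_comm_semigroup_def Suc_le_eq nonempty_has_size)
    then show "sum_mset W \<in> (\<Union>m\<in>{1::nat..}. Lam (\<lambda>\<rho>. real m *\<^sub>R M \<rho>) \<times> {int m})"
      using sum_in_Lam[OF W(1)] by (intro UN_I[of "size W"]) (auto simp: mem_Times_iff)
  qed
  show "(\<Union>m\<in>{1::nat..}. Lam (\<lambda>\<rho>. real m *\<^sub>R M \<rho>) \<times> {int m}) \<subseteq> sum_mset ` free_comm_semigroup (Lam M \<times> {1})"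
  proof clarify
    fix m :: nat and z assume "1 \<le> m" "z \<in> Lam (\<lambda>\<rho>. real m *\<^sub>R M \<rho>)"
    then obtain W where "set_mset W \<subseteq> Lam M \<times> {1}" "size W = m" "sum_mset W = (z, int m)" "m \<noteq> 0"
      using Lam_decompose[OF M] by (metis not_one_le_zero)
    then show "(z, int m) \<in> sum_mset ` free_comm_semigroup (Lam M \<times> {1})"
      by (intro image_eqI[of _ _ W]) (auto simp: free_comm_semigroup_def)
  qed
qed

end

subsection \<open>Weyl chambers and polytopes\<close>

context reduced_root_system
begin

definition chamber :: "'a \<Rightarrow> 'a set" where
  "chamber \<rho> = {v. \<forall>\<alpha>\<in>pos \<rho>. 0 < \<alpha> \<bullet> v}"

lemma chamber_self: "\<rho> \<in> chamber \<rho>"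
  by (simp add: chamber_def pos_def)

lemma chamber_eq_Inter: "chamber \<rho> = (\<Inter>\<alpha>\<in>pos \<rho>. {v. 0 < \<alpha> \<bullet> v})"
  by (auto simp: chamber_def)

lemma convex_chamber: "convex (chamber \<rho>)"
  unfolding chamber_eq_Inter by (intro convex_INT) (simp add: convex_halfspace_gt)

lemma open_chamber: "open (chamber \<rho>)"
  unfolding chamber_eq_Inter by (intro open_INT) (simp_all add: open_halfspace_gt)

lemma pos_chamber:
  assumes r: "regular \<rho>" and v: "v \<in> chamber \<rho>"
  shows "regular v" "pos v = pos \<rho>"
proof -
  have "\<alpha> \<bullet> v \<noteq> 0 \<and> (0 < \<alpha> \<bullet> v \<longleftrightarrow> \<alpha> \<in> pos \<rho>)" if "\<alpha> \<in> \<Delta>" for \<alpha>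
    by (rule pos_cases[OF r that]) (use v in \<open>force simp: chamber_def\<close>)+
  then show "regular v" "pos v = pos \<rho>" by (auto simp: regular_def pos_def)
qed

text \<open>The chamber is convex and avoids all walls, hence lies in the component. Conversely, a
  connected set on which a root changes sign meets the wall of that root.\<close>

lemma connected_component_chamber:
  assumes r: "regular \<rho>"
  shows "connected_component_set (- (\<Union>\<alpha>\<in>\<Delta>. {v. \<alpha> \<bullet> v = 0})) \<rho> = chamber \<rho>" (is "?L = _")
proof
  show "chamber \<rho> \<subseteq> ?L"
    using pos_chamber(1)[OF r]
    by (intro connected_component_maximal chamber_self convex_connected convex_chamber)
      (auto simp: regular_def)
  show "?L \<subseteq> chamber \<rho>"
  proof
    fix x assume x: "x \<in> ?L"
    have "0 < \<alpha> \<bullet> x" if a: "\<alpha> \<in> pos \<rho>" for \<alpha>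
    proof (rule ccontr)
      assume "\<not> ?thesis"
      moreover have "\<rho> \<in> ?L" using x by (auto intro: connected_component_refl dest: connected_component_in)
      ultimately obtain v where v: "v \<in> ?L" "\<alpha> \<bullet> v = 0"
        using connected_ivt_hyperplane[of ?L x \<rho> \<alpha> 0] x a by (auto simp: pos_def)
      then show False using connected_component_subset pos_root[OF a] by fastforce
    qed
    then show "x \<in> chamber \<rho>" by (simp add: chamber_def)
  qed
qed

lemma weyl_chambers_eq: "weyl_chambers \<Delta> = chamber ` {\<rho>. regular \<rho>}"
proof -
  have "- (\<Union>\<alpha>\<in>\<Delta>. {v. \<alpha> \<bullet> v = 0}) = {\<rho>. regular \<rho>}" by (auto simp: regular_def)
  then show ?thesis
    using connected_component_chamber by (auto simp: weyl_chambers_def components_def)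
qed

lemma positive_roots_chamber:
  assumes r: "regular \<rho>"
  shows "positive_roots \<Delta> (chamber \<rho>) = pos \<rho>"
  using chamber_self[of \<rho>] by (auto simp: positive_roots_def pos_def chamber_def)

lemma simple_roots_chamber: "regular \<rho> \<Longrightarrow> simple_roots \<Delta> (chamber \<rho>) = base \<rho>"
  by (simp add: simple_roots_def positive_roots_chamber base_def)

lemma closure_chamber: "closure (chamber \<rho>) = {v. \<forall>\<alpha>\<in>pos \<rho>. 0 \<le> \<alpha> \<bullet> v}"
proof
  have "closed (\<Inter>\<alpha>\<in>pos \<rho>. {v. 0 \<le> \<alpha> \<bullet> v})"
    by (intro closed_INT) (simp add: closed_halfspace_ge)
  moreover have "(\<Inter>\<alpha>\<in>pos \<rho>. {v. 0 \<le> \<alpha> \<bullet> v}) = {v. \<forall>\<alpha>\<in>pos \<rho>. 0 \<le> \<alpha> \<bullet> v}" by auto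
  ultimately show "closure (chamber \<rho>) \<subseteq> {v. \<forall>\<alpha>\<in>pos \<rho>. 0 \<le> \<alpha> \<bullet> v}"
    by (intro closure_minimal) (auto simp: chamber_def less_imp_le)
  show "{v. \<forall>\<alpha>\<in>pos \<rho>. 0 \<le> \<alpha> \<bullet> v} \<subseteq> closure (chamber \<rho>)"
  proof
    fix v assume v: "v \<in> {v. \<forall>\<alpha>\<in>pos \<rho>. 0 \<le> \<alpha> \<bullet> v}"
    have "(\<lambda>n. v + inverse (real (Suc n)) *\<^sub>R \<rho>) \<longlonglongrightarrow> v + 0 *\<^sub>R \<rho>"
      by (intro tendsto_intros LIMSEQ_inverse_real_of_nat)
    moreover have "v + inverse (real (Suc n)) *\<^sub>R \<rho> \<in> chamber \<rho>" for n
      using v by (auto simp: chamber_def inner_add_right pos_def intro!: add_nonneg_pos mult_pos_pos)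
    ultimately show "v \<in> closure (chamber \<rho>)"
      unfolding closure_sequential by (intro exI[of _ "\<lambda>n. v + inverse (real (Suc n)) *\<^sub>R \<rho>"]) simp
  qed
qed

lemma aff_dim_chamber: "aff_dim (chamber \<rho>) = DIM('a)"
  using aff_dim_open[OF open_chamber] chamber_self by blast

text \<open>The vector \<open>w\<close>, the sum of \<rho> and its mirror image, lies on the wall,
  and every positive root other than \<open>a\<close> is strictly positive on it because it is
  positive on both chambers. So a neighbourhood of \<open>w\<close> in the wall belongs to the
  closed chamber, which gives the full dimension of a facet.\<close>

lemma facet_chamber:
  assumes r: "regular \<rho>" and a: "a \<in> base \<rho>"
  shows "(closure (chamber \<rho>) \<inter> {v. a \<bullet> v = 0}) facet_of closure (chamber \<rho>)"
  unfolding facet_of_def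
proof (intro conjI)
  let ?F = "closure (chamber \<rho>) \<inter> {v. a \<bullet> v = 0}"
  define U where "U = {v. \<forall>\<alpha>\<in>pos \<rho> - {a}. 0 < \<alpha> \<bullet> v}"
  define w where "w = \<rho> + root_reflection a \<rho>"
  have aw: "a \<bullet> w = 0"
    using inner_root_reflection[of a \<rho> a] by (simp add: w_def inner_add_right inner_commute)
  have "open U"
  proof -
    have "U = (\<Inter>\<alpha>\<in>pos \<rho> - {a}. {v. 0 < \<alpha> \<bullet> v})" by (auto simp: U_def)
    then show ?thesis by (auto intro!: open_INT open_halfspace_gt)
  qed
  moreover have "w \<in> U"
    using pos_simple_reflection[OF r a]
    by (auto simp: U_def w_def inner_add_right pos_def intro!: add_pos_pos)
  ultimately have "aff_dim ({v. a \<bullet> v = 0} \<inter> U) = aff_dim {v. a \<bullet> v = 0}"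
    using aw by (intro aff_dim_convex_Int_open convex_hyperplane) auto
  moreover have U_closure: "v \<in> closure (chamber \<rho>)" if "v \<in> U" "a \<bullet> v = 0" for v
    unfolding closure_chamber
  proof (intro CollectI ballI)
    fix \<alpha> assume "\<alpha> \<in> pos \<rho>"
    then show "0 \<le> \<alpha> \<bullet> v" using that by (cases "\<alpha> = a") (auto simp: U_def less_imp_le)
  qed
  then have "{v. a \<bullet> v = 0} \<inter> U \<subseteq> ?F" by blast
  moreover have "a \<noteq> 0" using base_root[OF a] zero_not_root by blast
  ultimately have "DIM('a) - 1 \<le> aff_dim ?F"
    using aff_dim_subset[of "{v. a \<bullet> v = 0} \<inter> U" ?F] aff_dim_hyperplane[of a 0] by simp
  moreover have "aff_dim ?F \<le> DIM('a) - 1"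
    using aff_dim_subset[of ?F "{v. a \<bullet> v = 0}"] aff_dim_hyperplane[of a 0] \<open>a \<noteq> 0\<close> by simp
  ultimately show "aff_dim ?F = aff_dim (closure (chamber \<rho>)) - 1"
    by (simp add: aff_dim_chamber)
  show "?F face_of closure (chamber \<rho>)"
    using base_pos[OF a]
    by (intro face_of_Int_supporting_hyperplane_ge convex_closure convex_chamber) (auto simp: closure_chamber)
  have "w \<in> ?F" using aw \<open>w \<in> U\<close> U_closure by blast
  then show "?F \<noteq> {}" by blast
qed

lemma adjacent_chamber:
  assumes r: "regular \<rho>" and a: "a \<in> base \<rho>"
  shows "adjacent (chamber \<rho>) (chamber (root_reflection a \<rho>))"
proof -
  let ?r = "root_reflection a \<rho>"
  have p: "pos ?r = insert (- a) (pos \<rho> - {a})" by (rule pos_simple_reflection[OF r a])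
  have "closure (chamber \<rho>) \<inter> closure (chamber ?r) = closure (chamber \<rho>) \<inter> {v. a \<bullet> v = 0}"
    "closure (chamber \<rho>) \<inter> closure (chamber ?r) = closure (chamber ?r) \<inter> {v. - a \<bullet> v = 0}"
    using base_pos[OF a] by (force simp: closure_chamber p)+
  then show ?thesis
    unfolding adjacent_def
    using facet_chamber[OF r a]
      facet_chamber[OF regular_reflection[OF r base_root[OF a]] uminus_base_reflection[OF a]] by simp
qed

lemma separating_root_chamber:
  assumes r: "regular \<rho>" and a: "a \<in> base \<rho>"
  shows "separating_root \<Delta> (chamber \<rho>) (chamber (root_reflection a \<rho>)) = a"
  unfolding separating_root_def
proof (rule the_equality)
  let ?r = "root_reflection a \<rho>"
  have p: "pos ?r = insert (- a) (pos \<rho> - {a})" by (rule pos_simple_reflection[OF r a])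
  show "a \<in> \<Delta> \<and> (\<forall>v\<in>chamber \<rho>. 0 < a \<bullet> v) \<and> (\<forall>v\<in>chamber ?r. a \<bullet> v < 0)"
    using base_pos[OF a] pos_root by (auto simp: chamber_def p)
  fix \<alpha> assume \<alpha>: "\<alpha> \<in> \<Delta> \<and> (\<forall>v\<in>chamber \<rho>. 0 < \<alpha> \<bullet> v) \<and> (\<forall>v\<in>chamber ?r. \<alpha> \<bullet> v < 0)"
  then have "\<alpha> \<in> pos \<rho>" "\<alpha> \<notin> pos ?r" using chamber_self[of \<rho>] chamber_self[of ?r]
    by (force simp: pos_def)+
  then show "\<alpha> = a" by (auto simp: p)
qed

section \<open>Special ample polytopes as vertex systems\<close>

lemma weight_integral: "x \<in> weight_lattice \<Delta> \<Longrightarrow> integral_wt x"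
  by (simp add: weight_lattice_def integral_wt_def coroot_lattice_def integer_span_superset)

lemma special_vertex_system:
  assumes "special_ample_polytope \<Delta> P \<mu>"
  shows "vertex_system (\<lambda>\<rho>. \<mu> (chamber \<rho>))"
  unfolding vertex_system_def
proof (intro conjI allI impI ballI)
  note ample = assms[unfolded special_ample_polytope_def ample_polytope_def]
  fix \<rho> assume r: "regular \<rho>"
  then have c: "chamber \<rho> \<in> weyl_chambers \<Delta>" by (auto simp: weyl_chambers_eq)
  show "integral_wt (\<mu> (chamber \<rho>))" using ample c weight_integral by blast
  have "dominant \<Delta> (chamber \<rho>) (\<mu> (chamber \<rho>))" using ample c by blast
  then show "dom \<rho> (\<mu> (chamber \<rho>))"
    using pairing_neg_iff[OF base_root]
    by (force simp: dom_base_iff[OF r] dominant_def simple_roots_chamber[OF r] simp flip: not_less)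
  fix a assume a: "a \<in> base \<rho>"
  then have "chamber (root_reflection a \<rho>) \<in> weyl_chambers \<Delta>"
    using regular_reflection[OF r base_root] by (auto simp: weyl_chambers_eq)
  then obtain k :: int where "0 < k" "\<mu> (chamber \<rho>) - \<mu> (chamber (root_reflection a \<rho>))
      = of_int k *\<^sub>R separating_root \<Delta> (chamber \<rho>) (chamber (root_reflection a \<rho>))"
    using ample c adjacent_chamber[OF r a] by blast
  then show "\<exists>k\<ge>0. \<mu> (chamber \<rho>) - \<mu> (chamber (root_reflection a \<rho>)) = of_int k *\<^sub>R a"
    using separating_root_chamber[OF r a] by (auto intro!: exI[of _ k])
qed (simp add: chamber_def)

text \<open>The polytope is the hull of its vertices, which satisfy the convex inequalities.
  Conversely, let \<open>v\<close> be the normal of a hyperplane strictly separating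
  \<open>x\<close> from the polytope, with smaller value at \<open>x\<close>. The inequality at the
  vertex of a chamber for which \<open>- v\<close> is dominant says that \<open>v\<close> is no
  larger at this vertex than at \<open>x\<close>, a contradiction.\<close>

lemma special_polytope_eq:
  assumes P: "special_ample_polytope \<Delta> P \<mu>"
  shows "P = {x. \<forall>\<rho>. regular \<rho> \<longrightarrow> above \<rho> (\<mu> (chamber \<rho>) - x)}" (is "P = ?R")
proof
  have V: "vertex_system (\<lambda>\<rho>. \<mu> (chamber \<rho>))" using special_vertex_system[OF P] .
  have poly: "polytope P" and ext: "{x. x extreme_point_of P} = \<mu> ` weyl_chambers \<Delta>"
    using P by (auto simp: special_ample_polytope_def ample_polytope_def)
  have "convex ?R"
  proof (rule convexI, intro CollectI allI impI)
    fix x y :: 'a and u v :: real and \<rho>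
    assume xy: "x \<in> ?R" "y \<in> ?R" and uv: "0 \<le> u" "0 \<le> v" "u + v = 1" and r: "regular \<rho>"
    have "\<mu> (chamber \<rho>) - (u *\<^sub>R x + v *\<^sub>R y)
        = u *\<^sub>R (\<mu> (chamber \<rho>) - x) + v *\<^sub>R (\<mu> (chamber \<rho>) - y)"
      using uv(3) by (simp add: algebra_simps flip: scaleR_left_distrib)
    then show "above \<rho> (\<mu> (chamber \<rho>) - (u *\<^sub>R x + v *\<^sub>R y))"
      using xy uv r by (auto intro!: above_add above_scale)
  qed
  moreover have "\<mu> ` weyl_chambers \<Delta> \<subseteq> ?R"
    using vertex_diff[OF V] by (auto simp: weyl_chambers_eq)
  ultimately have "convex hull (\<mu> ` weyl_chambers \<Delta>) \<subseteq> ?R" by (intro hull_minimal)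
  then show "P \<subseteq> ?R"
    using Krein_Milman_Minkowski[of P] polytope_imp_compact[OF poly] polytope_imp_convex[OF poly] ext
    by simp
  show "?R \<subseteq> P"
  proof
    fix x assume x: "x \<in> ?R"
    show "x \<in> P"
    proof (rule ccontr)
      assume "x \<notin> P"
      then obtain v b where v: "v \<bullet> x < b" "\<And>p. p \<in> P \<Longrightarrow> b < v \<bullet> p"
        using separating_hyperplane_closed_point[of P x] polytope_imp_closed[OF poly]
          polytope_imp_convex[OF poly] by blast
      obtain \<rho> where r: "regular \<rho>" "dom \<rho> (- v)" using dom_exists by blast
      have "\<mu> (chamber \<rho>) \<in> P" using ext r by (auto simp: weyl_chambers_eq extreme_point_of_def)
      then have "b < v \<bullet> \<mu> (chamber \<rho>)" using v by blast
      moreover have "0 \<le> (- v) \<bullet> (\<mu> (chamber \<rho>) - x)"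
        using dom_above[OF r] x r(1) by blast
      ultimately show False using v(1) by (simp add: inner_diff_right)
    qed
  qed
qed

text \<open>The vertices differ by elements of the root lattice, so the lattice condition at one
  chamber is the condition at all. The description of \<open>P\<close> by inequalities is a
  hypothesis so that the lemma applies to the dilations as well.\<close>

lemma lattice_points_eq:
  assumes V: "vertex_system (\<lambda>\<rho>. \<mu> (chamber \<rho>))"
    and P: "P = {x. \<forall>\<rho>. regular \<rho> \<longrightarrow> above \<rho> (\<mu> (chamber \<rho>) - x)}" and r: "regular \<rho>"
  shows "lattice_points \<Delta> P \<mu> (chamber \<rho>) = Lam (\<lambda>\<rho>. \<mu> (chamber \<rho>))"
proof -
  have "x \<in> (+) (\<mu> (chamber \<rho>)) ` root_lattice \<Delta> \<longleftrightarrow>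
      (\<forall>\<tau>. regular \<tau> \<longrightarrow> \<mu> (chamber \<tau>) - x \<in> root_lattice \<Delta>)" for x
  proof
    assume "x \<in> (+) (\<mu> (chamber \<rho>)) ` root_lattice \<Delta>"
    then obtain y where y: "y \<in> root_lattice \<Delta>" "x = \<mu> (chamber \<rho>) + y" by blast
    show "\<forall>\<tau>. regular \<tau> \<longrightarrow> \<mu> (chamber \<tau>) - x \<in> root_lattice \<Delta>"
    proof (intro allI impI)
      fix \<tau> assume t: "regular \<tau>"
      have "(\<mu> (chamber \<tau>) - \<mu> (chamber \<rho>)) - y \<in> root_lattice \<Delta>"
        by (intro root_lattice_closed(3) y(1) conjunct1[OF vertex_diff[OF V t r]])
      then show "\<mu> (chamber \<tau>) - x \<in> root_lattice \<Delta>" by (simp add: y(2) diff_diff_eq)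
    qed
  next
    assume "\<forall>\<tau>. regular \<tau> \<longrightarrow> \<mu> (chamber \<tau>) - x \<in> root_lattice \<Delta>"
    then have "- (\<mu> (chamber \<rho>) - x) \<in> root_lattice \<Delta>" using r by (intro root_lattice_closed(4)) blast
    then show "x \<in> (+) (\<mu> (chamber \<rho>)) ` root_lattice \<Delta>"
      by (intro image_eqI[of _ _ "- (\<mu> (chamber \<rho>) - x)"]) auto
  qed
  then show ?thesis unfolding lattice_points_def Lam_def P by blast
qed

lemma dilated_polytope_eq:
  assumes P: "P = {x. \<forall>\<rho>. regular \<rho> \<longrightarrow> above \<rho> (M \<rho> - x)}" and m: "0 < (c::real)"
  shows "(*\<^sub>R) c ` P = {x. \<forall>\<rho>. regular \<rho> \<longrightarrow> above \<rho> (c *\<^sub>R M \<rho> - x)}"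
proof -
  have iff: "above \<rho> (M \<rho> - inverse c *\<^sub>R x) \<longleftrightarrow> above \<rho> (c *\<^sub>R M \<rho> - x)" if "regular \<rho>" for \<rho> x
    using m that by (auto simp: above_def coord_simps field_simps)
  have "x \<in> (*\<^sub>R) c ` P \<longleftrightarrow> inverse c *\<^sub>R x \<in> P" for x
    using m by (force intro: image_eqI[of _ _ "inverse c *\<^sub>R x"])
  then show ?thesis using iff unfolding P by auto
qed

end

theorem theorem1p4:
  fixes \<Delta> P :: "'a::euclidean_space set" and \<mu> :: "'a set \<Rightarrow> 'a" and \<sigma> :: "'a set"
  assumes "root_system \<Delta>" and "reduced \<Delta>" and "irreducible_roots \<Delta>"
    and "special_ample_polytope \<Delta> P \<mu>"
    and "\<sigma> \<in> weyl_chambers \<Delta>"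
  shows "polytope_semigroup \<Delta> P \<mu> \<sigma> = saturated_semigroup \<Delta> P \<mu> \<sigma>
    \<and> presented_by (polytope_semigroup \<Delta> P \<mu> \<sigma>)
        (lattice_points \<Delta> P \<mu> \<sigma> \<times> {1})
        (quadratic_relations (lattice_points \<Delta> P \<mu> \<sigma>))"
proof -
  interpret reduced_root_system \<Delta> using assms(1,2) by unfold_locales
  define M where "M = (\<lambda>\<rho>. \<mu> (chamber \<rho>))"
  have V: "vertex_system M" and P: "P = {x. \<forall>\<rho>. regular \<rho> \<longrightarrow> above \<rho> (M \<rho> - x)}"
    using special_vertex_system special_polytope_eq assms(4) by (auto simp: M_def)
  obtain \<rho> where r: "regular \<rho>" and \<sigma>: "\<sigma> = chamber \<rho>" using assms(5) by (auto simp: weyl_chambers_eq)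
  have L: "lattice_points \<Delta> P \<mu> \<sigma> = Lam M"
    using lattice_points_eq[OF V[unfolded M_def] P[unfolded M_def] r] by (simp add: \<sigma> M_def)
  have "lattice_points \<Delta> ((*\<^sub>R) (real m) ` P) (\<lambda>\<tau>. real m *\<^sub>R \<mu> \<tau>) \<sigma> = Lam (\<lambda>\<rho>. real m *\<^sub>R M \<rho>)"
    if "1 \<le> m" for m
    using lattice_points_eq[of "\<lambda>\<tau>. real m *\<^sub>R \<mu> \<tau>", OF vertex_system_scale[OF V, unfolded M_def]
        dilated_polytope_eq[OF P, of "real m", unfolded M_def] r] that
    by (simp add: \<sigma> M_def)
  then have "saturated_semigroup \<Delta> P \<mu> \<sigma> = generated_semigroup (Lam M \<times> {1})"
    unfolding saturated_semigroup_def generated_semigroup_Lam[OF V] by simp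
  then show ?thesis
    unfolding polytope_semigroup_def L using presented_by_Lam[OF V] by simp
qed

end
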